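(* Let $\beta>0$ be a constant and $q\equiv 0$, and let $u$ be the solution of $-\beta u''=f$ on $(x_l,x_r)$ with the given linear boundary conditions. Let $u\in H^2(x_l,x_r)$, $f\in L^2(x_l,x_r)$, and let $u_h$ be the finite element solution obtained using the $P_1$ finite element space on the mesh $x_l=x_0<x_1<\cdots<x_n=x_r$. Define $$u_h^{new}(x)=u_h(x)-\frac{1}{2\beta}(x-x_k)(x-x_{k+1})\,f(x),\qquad x_k<x<x_{k+1},\quad k=0,\dots,n-1.$$ Then $u_h^{new}$ is a third order approximation to the true solution $u$: there is a constant $C$ independent of $h$ such that $$\|u-u_h^{new}\|_{L^2}\le Ch^3,\qquad \|u-u_h^{new}\|_{H^1}\le Ch^2,\qquad \|u-u_h^{new}\|_{e}\le Ch^2 .$$ Moreover, $u_h^{new}(x_k)=u(x_k)$ for all $k$.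
   Context: The boundary value problem is the one-dimensional problem $-(\beta u')'+qu=f$ on $(x_l,x_r)$, here with $\beta>0$ constant and $q=0$, with linear boundary conditions (Dirichlet, Neumann or Robin) at $x=x_l$ and $x=x_r$, a Dirichlet condition being imposed at at least one endpoint so that the problem has a unique solution. Mesh: $x_l=x_0<x_1<\cdots<x_n=x_r$, mesh size $h=\max_i|x_{i+1}-x_i|$, with $h\sim O(1/n)$. Weak form: $a(u,v)=L(v)$ for all test functions $v\in H^1(x_l,x_r)$ vanishing at the Dirichlet endpoints, where $a(u,v)=\int_{x_l}^{x_r}\beta u'v'\,dx+R_1(u,v)$ and $L(v)=\int_{x_l}^{x_r}fv\,dx+R_2(v)$. Here $R_1$ and $R_2$ are the standard contributions of the boundary conditions obtained by integration by parts, and $R_1=R_2=0$ for homogeneous Dirichlet conditions at both ends. $P_1$ finite element solution: $\phi_i$ is the hat function, i.e. the continuous function that is linear on each $[x_k,x_{k+1}]$ with $\phi_i(x_j)=\delta_{ij}$. The space $V_h$ is spanned by the hat functions of the $M$ nodes that carry no Dirichlet condition ($M=n-1$, $n$ or $n+1$ depending on the boundary conditions). The finite element solution $u_h$ is the continuous piecewise linear function, with the prescribed values at the Dirichlet endpoints (so $u_h=\sum_{j=1}^M c_j^*\phi_j$ in the homogeneous case), that satisfies $a(u_h,\phi_i)=L(\phi_i)$ for all $\phi_i\in V_h$. Equivalently, it minimizes the energy error. The energy norm is $\|v\|_e=\sqrt{a(v,v)}$. The norms $L^2$ and $H^1$ are over $(x_l,x_r)$. At a node $x_k$ the correction term is understood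 to vanish, so $u_h^{new}(x_k)=u_h(x_k)$. $C$ is a generic error constant, independent of $h$.
   Formalization: The three error bounds are proved for f in H^1, since for f only in L^2 they fail (a jump of f inside a cell gives L^2 error of order h^{5/2}, and u_h^new is not in H^1); u_h^new(x_k)=u(x_k) is proved for f in L^2. Unique solvability is assumed explicitly. *)

theory Defs
  imports "HOL-Analysis.Analysis"
begin

section \<open>Sobolev spaces on a bounded interval\<close>

definition L2 :: "real \<Rightarrow> real \<Rightarrow> (real \<Rightarrow> real) set" where
  "L2 a b = {v. v \<in> borel_measurable (lebesgue_on {a<..<b}) \<and>
                integrable (lebesgue_on {a<..<b}) (\<lambda>x. (v x)\<^sup>2)}"

definition L2_norm :: "real \<Rightarrow> real \<Rightarrow> (real \<Rightarrow> real) \<Rightarrow> real" where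
  "L2_norm a b v = sqrt (\<integral>x. (v x)\<^sup>2 \<partial>lebesgue_on {a<..<b})"

text \<open>\<open>\<phi>\<close> is a \<open>C\<^sup>1\<close> function with compact support in \<open>(a, b)\<close>, with derivative \<open>\<phi>'\<close>.
  Testing with such functions instead of \<open>C\<^sup>\<infinity>\<close> ones is the convention of Brezis and
  gives the same weak derivatives.\<close>

definition test_function :: "real \<Rightarrow> real \<Rightarrow> (real \<Rightarrow> real) \<Rightarrow> (real \<Rightarrow> real) \<Rightarrow> bool" where
  "test_function a b \<phi> \<phi>' \<longleftrightarrow>
     (\<forall>x. (\<phi> has_real_derivative \<phi>' x) (at x)) \<and> continuous_on UNIV \<phi>' \<and>
     (\<exists>c d. a < c \<and> d < b \<and> (\<forall>x. x \<notin> {c..d} \<longrightarrow> \<phi> x = 0))"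

text \<open>Only used for \<open>v\<close> and \<open>g\<close> in \<open>L2 a b\<close>, so that both integrals exist.\<close>

definition has_weak_deriv :: "real \<Rightarrow> real \<Rightarrow> (real \<Rightarrow> real) \<Rightarrow> (real \<Rightarrow> real) \<Rightarrow> bool" where
  "has_weak_deriv a b v g \<longleftrightarrow>
     (\<forall>\<phi> \<phi>'. test_function a b \<phi> \<phi>' \<longrightarrow>
        (\<integral>x. v x * \<phi>' x \<partial>lebesgue_on {a<..<b}) = - (\<integral>x. g x * \<phi> x \<partial>lebesgue_on {a<..<b}))"

definition H1 :: "real \<Rightarrow> real \<Rightarrow> (real \<Rightarrow> real) set" where
  "H1 a b = {v \<in> L2 a b. \<exists>g \<in> L2 a b. has_weak_deriv a b v g}"

text \<open>A representative of the weak derivative, which is unique only up to null sets;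
  meaningful for \<open>v \<in> H1 a b\<close>.\<close>

definition weak_deriv :: "real \<Rightarrow> real \<Rightarrow> (real \<Rightarrow> real) \<Rightarrow> real \<Rightarrow> real" where
  "weak_deriv a b v = (SOME g. g \<in> L2 a b \<and> has_weak_deriv a b v g)"

definition H1_norm :: "real \<Rightarrow> real \<Rightarrow> (real \<Rightarrow> real) \<Rightarrow> real" where
  "H1_norm a b v = sqrt ((L2_norm a b v)\<^sup>2 + (L2_norm a b (weak_deriv a b v))\<^sup>2)"

definition H2 :: "real \<Rightarrow> real \<Rightarrow> (real \<Rightarrow> real) set" where
  "H2 a b = {v \<in> H1 a b. weak_deriv a b v \<in> H1 a b}"

section \<open>The boundary value problem\<close>

text \<open>\<open>Dirichlet g\<close> stands for \<open>u = g\<close>, \<open>Neumann g\<close> for \<open>u' = g\<close> and \<open>Robin c d g\<close> for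
  \<open>c u + d u' = g\<close>. At both endpoints \<open>u'\<close> is the derivative in direction of increasing \<open>x\<close>,
  not the outward normal derivative.\<close>

datatype bc = is_Dirichlet: Dirichlet real | Neumann real | Robin real real real

fun valid_bc :: "bc \<Rightarrow> bool" where
  "valid_bc (Robin c d g) \<longleftrightarrow> d \<noteq> 0"
| "valid_bc _ \<longleftrightarrow> True"

fun satisfies_bc :: "bc \<Rightarrow> real \<Rightarrow> real \<Rightarrow> bool" where
  "satisfies_bc (Dirichlet g) v v' \<longleftrightarrow> v = g"
| "satisfies_bc (Neumann g) v v' \<longleftrightarrow> v' = g"
| "satisfies_bc (Robin c d g) v v' \<longleftrightarrow> c * v + d * v' = g"

text \<open>\<open>u\<close> solves \<open>- \<beta> u'' = f\<close> almost everywhere. Boundary and nodal values refer to continuous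
  representatives: \<open>u\<close> is required to be its own, and \<open>p\<close> is that of \<open>u'\<close>.\<close>

definition bvp_solution ::
  "real \<Rightarrow> real \<Rightarrow> real \<Rightarrow> bc \<Rightarrow> bc \<Rightarrow> (real \<Rightarrow> real) \<Rightarrow> (real \<Rightarrow> real) \<Rightarrow> bool" where
  "bvp_solution xl xr \<beta> bl br f u \<longleftrightarrow>
     u \<in> H2 xl xr \<and> continuous_on {xl..xr} u \<and>
     (AE x in lebesgue_on {xl<..<xr}. - \<beta> * weak_deriv xl xr (weak_deriv xl xr u) x = f x) \<and>
     (\<exists>p. continuous_on {xl..xr} p \<and>
          (AE x in lebesgue_on {xl<..<xr}. p x = weak_deriv xl xr u x) \<and>
          satisfies_bc bl (u xl) (p xl) \<and> satisfies_bc br (u xr) (p xr))"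

text \<open>Integration by parts turns \<open>- \<beta> u'' v\<close> into \<open>\<beta> u' v'\<close> plus the boundary terms
  \<open>- \<beta> u'(xr) v(xr) + \<beta> u'(xl) v(xl)\<close>. At a non-Dirichlet endpoint \<open>u'\<close> is eliminated by means
  of the boundary condition, \<open>u' = g / d - (c / d) u\<close>; at a Dirichlet endpoint \<open>v = 0\<close>.
  The part with \<open>u\<close> goes into the bilinear form, the part with \<open>g\<close> into the load.\<close>

fun bc_coeff :: "bc \<Rightarrow> real" where
  "bc_coeff (Robin c d g) = c / d"
| "bc_coeff _ = 0"

fun bc_load :: "bc \<Rightarrow> real" where
  "bc_load (Dirichlet g) = 0"
| "bc_load (Neumann g) = g"
| "bc_load (Robin c d g) = g / d"

definition bilin_form ::
  "real \<Rightarrow> real \<Rightarrow> real \<Rightarrow> bc \<Rightarrow> bc \<Rightarrow> (real \<Rightarrow> real) \<Rightarrow> (real \<Rightarrow> real) \<Rightarrow> real" where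
  "bilin_form xl xr \<beta> bl br v w =
     (\<integral>x. \<beta> * weak_deriv xl xr v x * weak_deriv xl xr w x \<partial>lebesgue_on {xl<..<xr})
     + \<beta> * bc_coeff br * v xr * w xr - \<beta> * bc_coeff bl * v xl * w xl"

definition load_form ::
  "real \<Rightarrow> real \<Rightarrow> real \<Rightarrow> bc \<Rightarrow> bc \<Rightarrow> (real \<Rightarrow> real) \<Rightarrow> (real \<Rightarrow> real) \<Rightarrow> real" where
  "load_form xl xr \<beta> bl br f w =
     (\<integral>x. f x * w x \<partial>lebesgue_on {xl<..<xr})
     + \<beta> * bc_load br * w xr - \<beta> * bc_load bl * w xl"

definition energy_norm ::
  "real \<Rightarrow> real \<Rightarrow> real \<Rightarrow> bc \<Rightarrow> bc \<Rightarrow> (real \<Rightarrow> real) \<Rightarrow> real" where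
  "energy_norm xl xr \<beta> bl br v = sqrt (bilin_form xl xr \<beta> bl br v v)"

section \<open>The \<open>P\<^sub>1\<close> finite element method\<close>

definition mesh :: "real \<Rightarrow> real \<Rightarrow> nat \<Rightarrow> (nat \<Rightarrow> real) \<Rightarrow> bool" where
  "mesh xl xr n x \<longleftrightarrow> n \<ge> 1 \<and> x 0 = xl \<and> x n = xr \<and> (\<forall>i<n. x i < x (Suc i))"

definition mesh_size :: "nat \<Rightarrow> (nat \<Rightarrow> real) \<Rightarrow> real" where
  "mesh_size n x = Max ((\<lambda>i. \<bar>x (Suc i) - x i\<bar>) ` {..<n})"

definition hat :: "nat \<Rightarrow> (nat \<Rightarrow> real) \<Rightarrow> nat \<Rightarrow> real \<Rightarrow> real" where
  "hat n x i t =
     (if 0 < i \<and> x (i - 1) \<le> t \<and> t \<le> x i then (t - x (i - 1)) / (x i - x (i - 1))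
      else if i < n \<and> x i \<le> t \<and> t \<le> x (Suc i) then (x (Suc i) - t) / (x (Suc i) - x i)
      else 0)"

definition free_nodes :: "bc \<Rightarrow> bc \<Rightarrow> nat \<Rightarrow> nat set" where
  "free_nodes bl br n =
     {i. i \<le> n \<and> \<not> (i = 0 \<and> is_Dirichlet bl) \<and> \<not> (i = n \<and> is_Dirichlet br)}"

definition fem_solution ::
  "real \<Rightarrow> real \<Rightarrow> real \<Rightarrow> bc \<Rightarrow> bc \<Rightarrow> (real \<Rightarrow> real) \<Rightarrow> nat \<Rightarrow> (nat \<Rightarrow> real) \<Rightarrow> (real \<Rightarrow> real) \<Rightarrow> bool"
  where
  "fem_solution xl xr \<beta> bl br f n x uh \<longleftrightarrow>
     (\<exists>c. \<forall>t\<in>{xl..xr}. uh t = (\<Sum>i\<le>n. c i * hat n x i t)) \<and>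
     (\<forall>g. bl = Dirichlet g \<longrightarrow> uh xl = g) \<and> (\<forall>g. br = Dirichlet g \<longrightarrow> uh xr = g) \<and>
     (\<forall>i\<in>free_nodes bl br n.
        bilin_form xl xr \<beta> bl br uh (hat n x i) = load_form xl xr \<beta> bl br f (hat n x i))"

text \<open>At most one summand is nonzero, and none is if \<open>t\<close> is a node.\<close>

definition u_new ::
  "real \<Rightarrow> (real \<Rightarrow> real) \<Rightarrow> nat \<Rightarrow> (nat \<Rightarrow> real) \<Rightarrow> (real \<Rightarrow> real) \<Rightarrow> real \<Rightarrow> real" where
  "u_new \<beta> f n x uh t =
     uh t - (\<Sum>k<n. if x k < t \<and> t < x (Suc k)
                     then 1 / (2 * \<beta>) * (t - x k) * (t - x (Suc k)) * f t else 0)"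

end

theory Submission
  imports Defs
begin

text \<open>
  Nodal exactness: the error \<open>e = u - u\<^sub>h\<close> is orthogonal to the hat functions in the energy form,
  and since the derivatives of the hat functions are piecewise constant, this only involves the
  nodal values of \<open>e\<close>. It says that the divided differences of \<open>e\<close> on neighbouring elements agree, so
  that the nodal interpolant of \<open>e\<close> is a linear function, which satisfies the homogeneous boundary
  conditions. Adding it to \<open>u\<close> gives another solution of the boundary value problem, so it
  vanishes by uniqueness. No coercivity is available for this, as the Robin coefficients may
  have any sign.

  Error bounds: on an element \<open>[c, d]\<close> of length \<open>h\<close> the error \<open>e\<close> solves \<open>- \<beta> e'' = f\<close> with zero
  boundary values, and the correction is the exact solution for a constant right-hand side.
  Replacing \<open>f\<close> by \<open>f(c)\<close> costs \<open>\<bar>f - f(c)\<bar> \<le> sqrt h * \<parallel>f'\<parallel>\<close>, which yields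
  the bound \<open>O(h\<^sup>2)\<close> for the derivative of the corrected error after summation. The corrected error
  also vanishes at the nodes, so the Poincare inequality on each element gains the third power of
  \<open>h\<close> for the function itself.

  Weak derivatives are handled through \<open>F(t) = F(a) + \<integral>\<^sub>a\<^sup>t g\<close>: by the du Bois-Reymond lemma a weakly
  differentiable function has such a representative, and Fubini's theorem gives the product rule.
\<close>

section \<open>Lebesgue and gauge integrals on an interval\<close>

lemma AE_lebesgue_on_Ioo_iff:
  "(AE x in lebesgue_on {a<..<b::real}. P x) \<longleftrightarrow> (AE x in lborel. x \<in> {a<..<b} \<longrightarrow> P x)"
  by (simp add: AE_restrict_space_iff AE_completion_iff)

text \<open>The endpoints form a null set. This is the bridge between the integrals over
  \<open>lebesgue_on {a<..<b}\<close> in the definitions and gauge integrals over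
  \<open>{a..b}\<close>, in which all computations are done.\<close>

lemma absolutely_integrable_on_Icc_iff_integrable:
  fixes f :: "real \<Rightarrow> real"
  shows "f absolutely_integrable_on {a..b} \<longleftrightarrow> integrable (lebesgue_on {a<..<b}) f"
  unfolding absolutely_integrable_on_Icc_iff_Ioo
  by (simp add: set_integrable_def integrable_restrict_space)

lemma integral_lebesgue_on_Ioo:
  fixes f :: "real \<Rightarrow> real"
  assumes "f absolutely_integrable_on {a..b}"
  shows "integral\<^sup>L (lebesgue_on {a<..<b}) f = integral {a..b} f"
  using assms lebesgue_integral_eq_integral[of "{a<..<b}" f]
  by (simp add: absolutely_integrable_on_Icc_iff_integrable integral_open_interval_real)

lemma has_integral_AE_Icc:
  fixes f g :: "real \<Rightarrow> real"
  assumes "AE x in lebesgue_on {a<..<b}. f x = g x" "a \<le> c" "d \<le> b"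
  shows "(f has_integral y) {c..d} \<longleftrightarrow> (g has_integral y) {c..d}"
  unfolding has_integral_Icc_iff_Ioo
  by (rule has_integral_AE) (use assms in \<open>auto simp: AE_lebesgue_on_Ioo_iff elim!: eventually_mono\<close>)

lemma absolutely_integrable_AE_Icc:
  fixes f g :: "real \<Rightarrow> real"
  assumes "AE x in lebesgue_on {a<..<b}. f x = g x" "f absolutely_integrable_on {a..b}"
  shows "g absolutely_integrable_on {a..b}"
proof -
  have "AE x in lebesgue_on {a<..<b}. norm (f x) = norm (g x)"
    using assms(1) by eventually_elim simp
  from has_integral_AE_Icc[OF this order_refl order_refl]
  have "(\<lambda>x. norm (f x)) integrable_on {a..b} \<longleftrightarrow> (\<lambda>x. norm (g x)) integrable_on {a..b}"
    by (simp add: integrable_on_def)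
  moreover have "f integrable_on {a..b} \<longleftrightarrow> g integrable_on {a..b}"
    using has_integral_AE_Icc[OF assms(1) order_refl order_refl] by (simp add: integrable_on_def)
  ultimately show ?thesis
    using assms(2) by (simp add: absolutely_integrable_on_def)
qed

text \<open>Fubini's theorem and the uniqueness of densities are applied to Borel functions on
  \<open>lborel\<close>, while \<open>g\<close> is only Lebesgue measurable. Changing
  \<open>g\<close> on a null set and cutting it off outside \<open>[a, b]\<close> makes it Borel
  without affecting any integral.\<close>

lemma absolutely_integrable_Borel_representative:
  fixes g :: "real \<Rightarrow> real"
  assumes "g absolutely_integrable_on {a..b}"
  obtains g0 where "integrable lborel g0"
    "AE x in lborel. indicator {a..b} x * g x = g0 x"
    "\<And>S. S \<in> sets borel \<Longrightarrow> S \<subseteq> {a..b} \<Longrightarrow> (LINT x|lborel. indicator S x * g0 x) = integral S g"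
proof -
  let ?g = "\<lambda>x. indicator {a..b} x * g x"
  have int: "integrable lebesgue ?g"
    using assms by (simp add: set_integrable_def)
  then obtain g0 where g0: "g0 \<in> borel_measurable lborel" "AE x in lborel. ?g x = g0 x"
    using completion_ex_borel_measurable_real[OF borel_measurable_integrable[OF int]] by auto
  have "integrable lebesgue g0"
    by (rule integrable_cong_AE_imp[OF int]) (use g0 in \<open>auto simp: AE_completion_iff intro: measurable_completion elim!: eventually_mono\<close>)
  then have 1: "integrable lborel g0"
    using g0 integrable_completion by blast
  show ?thesis
  proof (rule that[OF 1 g0(2)])
    fix S :: "real set" assume S: "S \<in> sets borel" "S \<subseteq> {a..b}"
    have "integrable lborel (\<lambda>x. indicator S x * g0 x)"
      using integrable_mult_indicator[OF _ 1, of S] S by simp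
    then have hi: "((\<lambda>x. indicator S x * g0 x) has_integral (LINT x|lborel. indicator S x * g0 x)) UNIV"
      by (rule has_integral_integral_lborel)
    have ae':  "AE x in lborel. x \<in> UNIV \<longrightarrow> indicator S x * g0 x = (if x \<in> S then g x else 0)"
      using g0(2) by (rule eventually_mono) (use S in \<open>auto simp: indicator_def split: if_splits\<close>)
    have "((\<lambda>x. if x \<in> S then g x else 0) has_integral (LINT x|lborel. indicator S x * g0 x)) UNIV"
      using has_integral_AE[OF ae'] hi by (rule iffD1)
    then have "(g has_integral (LINT x|lborel. indicator S x * g0 x)) S"
      by (simp add: has_integral_restrict_UNIV)
    then show "(LINT x|lborel. indicator S x * g0 x) = integral S g"
      by (simp add: integral_unique)
  qed
qed

text \<open>The source of uniqueness of weak derivatives. A measure-theoretic argument takes the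
  place of Lebesgue's differentiation theorem.\<close>

lemma zero_primitive_imp_AE_zero:
  fixes g :: "real \<Rightarrow> real"
  assumes "g absolutely_integrable_on {a..b}"
    and zero: "\<And>t. t \<in> {a..b} \<Longrightarrow> integral {a..t} g = 0"
  shows "AE x in lebesgue_on {a<..<b}. g x = 0"
proof -
  obtain g0 where int: "integrable lborel g0"
    and ae: "AE x in lborel. indicator {a..b} x * g x = g0 x"
    and eq: "\<And>S. S \<in> sets borel \<Longrightarrow> S \<subseteq> {a..b} \<Longrightarrow> (LINT x|lborel. indicator S x * g0 x) = integral S g"
    using absolutely_integrable_Borel_representative[OF assms(1)] by metis
  have [measurable]: "g0 \<in> borel_measurable borel"
    using int by auto
  have tail: "(LINT x|lborel. indicator {y<..} x * g0 x) = 0" for y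
  proof -
    have gi: "g integrable_on {a..b}"
      using assms(1) by (simp add: absolutely_integrable_on_def)
    let ?S = "{y<..} \<inter> {a..b}"
    have "(LINT x|lborel. indicator {y<..} x * g0 x) = (LINT x|lborel. indicator ?S x * g0 x)"
      by (rule integral_cong_AE) (use ae in \<open>auto simp: indicator_def elim!: eventually_mono\<close>)
    also have "\<dots> = integral ?S g"
      by (rule eq) auto
    also have "\<dots> = 0"
    proof (cases "y < a \<or> b \<le> y")
      case True
      then have "?S = {a..b} \<or> ?S = {}" by auto
      then show ?thesis
      proof
        assume "?S = {a..b}"
        then show ?thesis
          using zero[of b] by (cases "a \<le> b") (simp_all only: Henstock_Kurzweil_Integration.integral_empty atLeastAtMost_iff order_refl simp_thms atLeastatMost_empty not_le)
      next
        assume "?S = {}"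
        then show ?thesis
          by (simp only: Henstock_Kurzweil_Integration.integral_empty)
      qed
    next
      case False
      then have "integral {a..y} g + integral {y..b} g = integral {a..b} g"
        using gi by (intro Henstock_Kurzweil_Integration.integral_combine) auto
      then have "integral {y..b} g = 0"
        using zero[of b] zero[of y] False by auto
      moreover have "integral ?S g = integral {y..b} g"
        by (rule integral_subset_negligible) (use False in \<open>auto intro: negligible_subset[of "{y}"]\<close>)
      ultimately show ?thesis by simp
    qed
    finally show ?thesis .
  qed
  \<comment> \<open>The positive and the negative part of \<open>g0\<close> are densities of measures that agree on all rays.\<close>
  let ?p = "\<lambda>x. ennreal (g0 x)" and ?m = "\<lambda>x. ennreal (- g0 x)"
  have emP: "emeasure (density lborel ?p) {y<..} = ennreal (LINT x|lborel. indicator {y<..} x * max 0 (g0 x))" for y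
  proof -
    have "(\<integral>\<^sup>+x. ?p x * indicator {y<..} x \<partial>lborel) = (\<integral>\<^sup>+x. ennreal (indicator {y<..} x * max 0 (g0 x)) \<partial>lborel)"
      by (intro nn_integral_cong) (auto simp: indicator_def ennreal_max_0)
    also have "\<dots> = ennreal (LINT x|lborel. indicator {y<..} x * max 0 (g0 x))"
      using integrable_mult_indicator[of "{y<..}" lborel "\<lambda>x. max 0 (g0 x)"] int
      by (intro nn_integral_eq_integral) auto
    finally show ?thesis by (simp add: emeasure_density)
  qed
  have emM: "emeasure (density lborel ?m) {y<..} = ennreal (LINT x|lborel. indicator {y<..} x * max 0 (- g0 x))" for y
  proof -
    have "(\<integral>\<^sup>+x. ?m x * indicator {y<..} x \<partial>lborel) = (\<integral>\<^sup>+x. ennreal (indicator {y<..} x * max 0 (- g0 x)) \<partial>lborel)"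
      by (intro nn_integral_cong) (auto simp: indicator_def ennreal_max_0)
    also have "\<dots> = ennreal (LINT x|lborel. indicator {y<..} x * max 0 (- g0 x))"
      using integrable_mult_indicator[of "{y<..}" lborel "\<lambda>x. max 0 (- g0 x)"] int
      by (intro nn_integral_eq_integral) auto
    finally show ?thesis by (simp add: emeasure_density)
  qed
  have PM: "(LINT x|lborel. indicator {y<..} x * max 0 (g0 x)) = (LINT x|lborel. indicator {y<..} x * max 0 (- g0 x))" for y
  proof -
    have "(LINT x|lborel. indicator {y<..} x * max 0 (g0 x)) - (LINT x|lborel. indicator {y<..} x * max 0 (- g0 x))
        = (LINT x|lborel. indicator {y<..} x * max 0 (g0 x) - indicator {y<..} x * max 0 (- g0 x))"
      using integrable_mult_indicator[of "{y<..}" lborel "\<lambda>x. max 0 (g0 x)"]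
        integrable_mult_indicator[of "{y<..}" lborel "\<lambda>x. max 0 (- g0 x)"] int
      by (intro Bochner_Integration.integral_diff[symmetric]) auto
    also have "\<dots> = (LINT x|lborel. indicator {y<..} x * g0 x)"
      by (intro Bochner_Integration.integral_cong) (auto simp: indicator_def)
    finally show ?thesis using tail by simp
  qed
  have "density lborel ?p = density lborel ?m"
    by (rule measure_eqI_lessThan) (auto simp: emP emM PM)
  then have "AE x in lborel. ?p x = ?m x"
    by (intro sigma_finite_measure.density_unique[OF sigma_finite_lborel]) auto
  \<comment> \<open>\<open>ennreal\<close> sends negative numbers to 0, so at every point at least
    one of the two densities vanishes; where they agree, both do.\<close>
  then have "AE x in lborel. g0 x = 0"
    by (rule eventually_mono) (metis ennreal_eq_0_iff ennreal_inj le_cases neg_0_le_iff_le neg_le_0_iff_le order_antisym)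
  with ae have "AE x in lborel. x \<in> {a<..<b} \<longrightarrow> g x = 0"
    by eventually_elim (auto simp: indicator_def)
  then show ?thesis by (simp add: AE_lebesgue_on_Ioo_iff)
qed

section \<open>Fubini's theorem on a triangle\<close>

lemma integrable_lower_triangle:
  fixes g k :: "real \<Rightarrow> real"
  assumes g: "integrable lborel g" and k: "integrable lborel k"
  shows "integrable lborel (\<lambda>s. g s * (LINT r|lborel. indicator {..s} r * k r))"
proof -
  have [measurable]: "g \<in> borel_measurable borel" "k \<in> borel_measurable borel"
    using g k by auto
  have "integrable (lborel \<Otimes>\<^sub>M lborel) (\<lambda>(s, r). g s * k r)"
    by (rule lborel_pair.Fubini_integrable) (use g k in \<open>auto simp: abs_mult\<close>)
  then have "integrable (lborel \<Otimes>\<^sub>M lborel) (\<lambda>(s, r). g s * (indicator {..s} r * k r))"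
    by (rule Bochner_Integration.integrable_bound) (auto simp: indicator_def split: if_splits)
  then show ?thesis
    using lborel_pair.integrable_fst by fastforce
qed

text \<open>The plane is cut along the diagonal: for fixed \<open>s\<close> the integral of
  \<open>k\<close> is split at \<open>s\<close>, and in the part with \<open>r > s\<close> the order
  of integration is exchanged. This is integration by parts for indefinite integrals.\<close>

lemma integral_triangle_Fubini:
  fixes g k :: "real \<Rightarrow> real"
  assumes g: "integrable lborel g" and k: "integrable lborel k"
  shows "(LINT s|lborel. g s * (LINT r|lborel. indicator {..s} r * k r))
       + (LINT s|lborel. k s * (LINT r|lborel. indicator {..s} r * g r))
       = (LINT s|lborel. g s) * (LINT s|lborel. k s)"
proof -
  have [measurable]: "g \<in> borel_measurable borel" "k \<in> borel_measurable borel"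
    using g k by auto
  have prod: "integrable (lborel \<Otimes>\<^sub>M lborel) (\<lambda>(s, r). g s * k r)"
    by (rule lborel_pair.Fubini_integrable) (use g k in \<open>auto simp: abs_mult\<close>)
  have upper: "integrable (lborel \<Otimes>\<^sub>M lborel) (\<lambda>(s, r). g s * (indicator {s<..} r * k r))"
    by (rule Bochner_Integration.integrable_bound[OF prod]) (auto simp: indicator_def split: if_splits)
  \<comment> \<open>The exchange turns \<open>r > s\<close> into \<open>s < r\<close>; the diagonal
    is a null set, so the strict inequality may be relaxed.\<close>
  have strict: "(LINT s|lborel. indicator {..<r} s * g s) = (LINT s|lborel. indicator {..r} s * g s)" for r
    by (rule integral_cong_AE) (use AE_lborel_singleton[of r] in \<open>auto simp: indicator_def elim!: eventually_mono\<close>)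
  have ik: "integrable lborel (\<lambda>r. indicator {..s} r * k r)" "integrable lborel (\<lambda>r. indicator {s<..} r * k r)" for s
    using integrable_mult_indicator[of _ lborel k] k by auto
  have lower_int: "integrable lborel (\<lambda>s. g s * (LINT r|lborel. indicator {..s} r * k r))"
    using g k by (rule integrable_lower_triangle)
  have upper_int: "integrable lborel (\<lambda>s. g s * (LINT r|lborel. indicator {s<..} r * k r))"
    using lborel_pair.integrable_fst[OF upper] by simp
  have "(LINT s|lborel. g s) * (LINT r|lborel. k r) = (LINT s|lborel. g s * (LINT r|lborel. k r))"
    by simp
  also have "\<dots> = (LINT s|lborel. g s * (LINT r|lborel. indicator {..s} r * k r) + g s * (LINT r|lborel. indicator {s<..} r * k r))"
  proof (intro Bochner_Integration.integral_cong refl)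
    fix s
    have "(LINT r|lborel. k r) = (LINT r|lborel. indicator {..s} r * k r + indicator {s<..} r * k r)"
      by (intro Bochner_Integration.integral_cong) (auto simp: indicator_def)
    also have "\<dots> = (LINT r|lborel. indicator {..s} r * k r) + (LINT r|lborel. indicator {s<..} r * k r)"
      using ik by (rule Bochner_Integration.integral_add)
    finally show "g s * (LINT r|lborel. k r) = g s * (LINT r|lborel. indicator {..s} r * k r) + g s * (LINT r|lborel. indicator {s<..} r * k r)"
      by (simp add: algebra_simps)
  qed
  also have "\<dots> = (LINT s|lborel. g s * (LINT r|lborel. indicator {..s} r * k r)) + (LINT s|lborel. g s * (LINT r|lborel. indicator {s<..} r * k r))"
    using lower_int upper_int by (rule Bochner_Integration.integral_add)
  also have "(LINT s|lborel. g s * (LINT r|lborel. indicator {s<..} r * k r)) = (LINT s|lborel. (LINT r|lborel. g s * (indicator {s<..} r * k r)))"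
    by simp
  also have "\<dots> = (LINT r|lborel. (LINT s|lborel. g s * (indicator {s<..} r * k r)))"
    by (rule lborel_pair.Fubini_integral[symmetric, OF upper])
  also have "\<dots> = (LINT r|lborel. k r * (LINT s|lborel. indicator {..<r} s * g s))"
  proof (intro Bochner_Integration.integral_cong refl)
    fix r
    have "(LINT s|lborel. g s * (indicator {s<..} r * k r)) = (LINT s|lborel. k r * (indicator {..<r} s * g s))"
      by (intro Bochner_Integration.integral_cong) (auto simp: indicator_def)
    then show "(LINT s|lborel. g s * (indicator {s<..} r * k r)) = k r * (LINT s|lborel. indicator {..<r} s * g s)"
      by simp
  qed
  finally show ?thesis by (simp add: strict)
qed

section \<open>Indefinite integrals of integrable functions\<close>

text \<open>Absolute continuity of \<open>F\<close> on \<open>[a, b]\<close> with almost everywhere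
  derivative \<open>g\<close>, expressed through the integral so that no pointwise derivative is
  ever needed. Values of \<open>F\<close> outside \<open>[a, b]\<close> are unconstrained.\<close>

definition is_primitive :: "real \<Rightarrow> real \<Rightarrow> (real \<Rightarrow> real) \<Rightarrow> (real \<Rightarrow> real) \<Rightarrow> bool" where
  "is_primitive a b F g \<longleftrightarrow>
     g absolutely_integrable_on {a..b} \<and> (\<forall>t\<in>{a..b}. integral {a..t} g = F t - F a)"

lemma absolutely_integrable_continuous_mult:
  fixes F g :: "real \<Rightarrow> real"
  assumes "continuous_on {a..b} F" "g absolutely_integrable_on {a..b}"
  shows "(\<lambda>t. F t * g t) absolutely_integrable_on {a..b}"
proof (rule absolutely_integrable_bounded_measurable_product_real)
  show "F \<in> borel_measurable (lebesgue_on {a..b})"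
    using assms(1) by (intro continuous_imp_measurable_on_sets_lebesgue) auto
  show "bounded (F ` {a..b})"
    using assms(1) by (intro compact_imp_bounded compact_continuous_image) auto
qed (use assms in auto)

lemma is_primitive_absolutely_integrable:
  "is_primitive a b F g \<Longrightarrow> g absolutely_integrable_on {a..b}"
  by (simp add: is_primitive_def)

lemma absolutely_integrable_on_imp_integrable_on:
  fixes g :: "real \<Rightarrow> real"
  shows "g absolutely_integrable_on S \<Longrightarrow> g integrable_on S"
  by (simp add: absolutely_integrable_on_def)

lemma is_primitive_integrable:
  "is_primitive a b F g \<Longrightarrow> g integrable_on {a..b}"
  by (simp add: is_primitive_def absolutely_integrable_on_def)

lemma is_primitive_integral:
  assumes "is_primitive a b F g" "a \<le> b"
  shows "integral {a..b} g = F b - F a"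
  using assms by (simp add: is_primitive_def)

lemma is_primitive_continuous:
  assumes "is_primitive a b F g"
  shows "continuous_on {a..b} F"
proof -
  have "continuous_on {a..b} (\<lambda>t. F a + integral {a..t} g)"
    using is_primitive_integrable[OF assms]
    by (intro continuous_intros indefinite_integral_continuous_1)
  then show ?thesis
    by (rule continuous_on_eq) (use assms in \<open>auto simp: is_primitive_def\<close>)
qed

lemma is_primitive_indefinite_integral:
  "g absolutely_integrable_on {a..b} \<Longrightarrow> is_primitive a b (\<lambda>t. C + integral {a..t} g) g"
  by (simp add: is_primitive_def)

lemma is_primitive_const: "is_primitive a b (\<lambda>t. C) (\<lambda>t. 0)"
  by (simp add: is_primitive_def)

lemma is_primitive_cong:
  assumes "is_primitive a b F g" "\<And>t. t \<in> {a..b} \<Longrightarrow> F' t = F t"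
    "AE t in lebesgue_on {a<..<b}. g t = g' t"
  shows "is_primitive a b F' g'"
proof -
  have "integral {a..t} g = integral {a..t} g'" if "t \<in> {a..b}" for t
    using has_integral_AE_Icc[OF assms(3), of a t] that by (auto simp: integral_def integrable_on_def)
  then show ?thesis
    using assms absolutely_integrable_AE_Icc[OF assms(3)] by (auto simp: is_primitive_def)
qed

lemma is_primitive_subinterval:
  assumes "is_primitive a b F g" "a \<le> c" "d \<le> b"
  shows "is_primitive c d F g"
  unfolding is_primitive_def
proof (intro conjI ballI)
  show "g absolutely_integrable_on {c..d}"
    using is_primitive_absolutely_integrable[OF assms(1)] assms
    by (auto intro: absolutely_integrable_on_subinterval)
  fix t assume t: "t \<in> {c..d}"
  have "g integrable_on {a..t}"
    using is_primitive_integrable[OF assms(1)] t assms by (auto intro: integrable_on_subinterval)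
  then have "integral {a..c} g + integral {c..t} g = integral {a..t} g"
    using assms t by (intro Henstock_Kurzweil_Integration.integral_combine) auto
  moreover have "integral {a..t} g = F t - F a" "integral {a..c} g = F c - F a"
    using assms t by (auto simp: is_primitive_def)
  ultimately show "integral {c..t} g = F t - F c" by simp
qed

lemma is_primitive_diff_eq:
  assumes "is_primitive a b F g" "a \<le> s" "s \<le> t" "t \<le> b"
  shows "F t - F s = integral {s..t} g"
  using is_primitive_integral[OF is_primitive_subinterval[OF assms(1,2,4)] assms(3)] by simp

lemma is_primitive_add:
  assumes "is_primitive a b F g" "is_primitive a b G k"
  shows "is_primitive a b (\<lambda>t. F t + G t) (\<lambda>t. g t + k t)"
  unfolding is_primitive_def
proof (intro conjI ballI)
  show "(\<lambda>t. g t + k t) absolutely_integrable_on {a..b}"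
    using assms by (simp add: is_primitive_def)
  fix t assume t: "t \<in> {a..b}"
  have "g integrable_on {a..t}" "k integrable_on {a..t}"
    using assms[THEN is_primitive_subinterval, THEN is_primitive_integrable] t by auto
  then have "integral {a..t} (\<lambda>t. g t + k t) = integral {a..t} g + integral {a..t} k"
    by (rule Henstock_Kurzweil_Integration.integral_add)
  moreover have "integral {a..t} g = F t - F a" "integral {a..t} k = G t - G a"
    using assms t by (auto simp: is_primitive_def)
  ultimately show "integral {a..t} (\<lambda>t. g t + k t) = F t + G t - (F a + G a)"
    by simp
qed

lemma is_primitive_cmult:
  assumes "is_primitive a b F g"
  shows "is_primitive a b (\<lambda>t. c * F t) (\<lambda>t. c * g t)"
  using assms by (simp add: is_primitive_def right_diff_distrib)

lemma is_primitive_diff: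
  assumes "is_primitive a b F g" "is_primitive a b G k"
  shows "is_primitive a b (\<lambda>t. F t - G t) (\<lambda>t. g t - k t)"
  using is_primitive_add[OF assms(1) is_primitive_cmult[OF assms(2), of "-1"]] by simp

lemma is_primitive_sum:
  assumes "finite I" "\<And>i. i \<in> I \<Longrightarrow> is_primitive a b (F i) (g i)"
  shows "is_primitive a b (\<lambda>t. \<Sum>i\<in>I. F i t) (\<lambda>t. \<Sum>i\<in>I. g i t)"
  using assms by (induction I rule: finite_induct) (auto intro: is_primitive_const is_primitive_add)

lemma is_primitive_deriv:
  assumes "\<And>t. t \<in> {a..b} \<Longrightarrow> (F has_real_derivative g t) (at t within {a..b})"
    "continuous_on {a..b} g"
  shows "is_primitive a b F g"
  unfolding is_primitive_def
proof (intro conjI ballI)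
  show "g absolutely_integrable_on {a..b}"
    using assms(2) by (rule absolutely_integrable_continuous_real)
  fix t assume t: "t \<in> {a..b}"
  have "(g has_integral F t - F a) {a..t}"
  proof (rule fundamental_theorem_of_calculus)
    fix s assume s: "s \<in> {a..t}"
    then have "(F has_vector_derivative g s) (at s within {a..b})"
      using assms(1)[of s] t by (auto simp: has_real_derivative_iff_has_vector_derivative)
    then show "(F has_vector_derivative g s) (at s within {a..t})"
      by (rule has_vector_derivative_within_subset) (use t in auto)
  qed (use t in auto)
  then show "integral {a..t} g = F t - F a"
    by (simp add: integral_unique)
qed

text \<open>Carries \<open>integral_triangle_Fubini\<close> over to gauge integrals by means of
  Borel representatives: null sets affect neither the inner nor the outer integrals.\<close>

lemma integral_triangle:
  fixes g k :: "real \<Rightarrow> real"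
  assumes g: "g absolutely_integrable_on {a..t}" and k: "k absolutely_integrable_on {a..t}"
  shows "integral {a..t} (\<lambda>s. g s * integral {a..s} k) + integral {a..t} (\<lambda>s. k s * integral {a..s} g)
    = integral {a..t} g * integral {a..t} k"
proof -
  \<comment> \<open>One summand on the left, stated for arbitrary factors because the other one
    arises by exchanging \<open>g\<close> and \<open>k\<close>.\<close>
  have half: "(LINT s|lborel. indicator {a..t} s * p0 s * (LINT r|lborel. indicator {..s} r * (indicator {a..t} r * q0 r)))
      = integral {a..t} (\<lambda>s. p s * integral {a..s} q)"
    if p0: "integrable lborel p0" "AE x in lborel. indicator {a..t} x * p x = p0 x"
      and q0: "integrable lborel q0"
        "\<And>S. S \<in> sets borel \<Longrightarrow> S \<subseteq> {a..t} \<Longrightarrow> (LINT x|lborel. indicator S x * q0 x) = integral S q"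
    for p q p0 q0 :: "real \<Rightarrow> real"
  proof -
    let ?L = "\<lambda>s. indicator {a..t} s * p0 s * (LINT r|lborel. indicator {..s} r * (indicator {a..t} r * q0 r))"
    have "integrable lborel (\<lambda>s. indicator {a..t} s * p0 s)" "integrable lborel (\<lambda>s. indicator {a..t} s * q0 s)"
      using integrable_mult_indicator[of "{a..t}" lborel p0] integrable_mult_indicator[of "{a..t}" lborel q0] p0 q0
      by simp_all
    then have "integrable lborel ?L"
      by (rule integrable_lower_triangle)
    then have hi: "(?L has_integral integral\<^sup>L lborel ?L) UNIV"
      by (rule has_integral_integral_lborel)
    have inner: "(LINT r|lborel. indicator {..s} r * (indicator {a..t} r * q0 r)) = integral {a..s} q" if "s \<in> {a..t}" for s
    proof -
      have "(LINT r|lborel. indicator {..s} r * (indicator {a..t} r * q0 r)) = (LINT r|lborel. indicator {a..s} r * q0 r)"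
        by (intro Bochner_Integration.integral_cong) (use that in \<open>auto simp: indicator_def\<close>)
      then show ?thesis
        using q0(2)[of "{a..s}"] that by auto
    qed
    have ae: "AE s in lborel. s \<in> UNIV \<longrightarrow> ?L s = (if s \<in> {a..t} then p s * integral {a..s} q else 0)"
      using p0(2)
    proof eventually_elim
      case (elim s)
      show ?case
      proof (cases "s \<in> {a..t}")
        case True
        then show ?thesis using elim inner[OF True] by simp
      qed auto
    qed
    have "((\<lambda>s. if s \<in> {a..t} then p s * integral {a..s} q else 0) has_integral integral\<^sup>L lborel ?L) UNIV"
      using has_integral_AE[OF ae] hi by (rule iffD1)
    then have "((\<lambda>s. p s * integral {a..s} q) has_integral integral\<^sup>L lborel ?L) {a..t}"
      by (simp only: has_integral_restrict_UNIV)
    then show ?thesis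
      by (rule integral_unique[symmetric])
  qed
  obtain g0 where g0: "integrable lborel g0" "AE x in lborel. indicator {a..t} x * g x = g0 x"
     "\<And>S. S \<in> sets borel \<Longrightarrow> S \<subseteq> {a..t} \<Longrightarrow> (LINT x|lborel. indicator S x * g0 x) = integral S g"
    using absolutely_integrable_Borel_representative[OF g] by metis
  obtain k0 where k0: "integrable lborel k0" "AE x in lborel. indicator {a..t} x * k x = k0 x"
     "\<And>S. S \<in> sets borel \<Longrightarrow> S \<subseteq> {a..t} \<Longrightarrow> (LINT x|lborel. indicator S x * k0 x) = integral S k"
    using absolutely_integrable_Borel_representative[OF k] by metis
  have "integrable lborel (\<lambda>s. indicator {a..t} s * g0 s)" "integrable lborel (\<lambda>s. indicator {a..t} s * k0 s)"
    using integrable_mult_indicator[of "{a..t}" lborel g0] integrable_mult_indicator[of "{a..t}" lborel k0] g0 k0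
    by simp_all
  from integral_triangle_Fubini[OF this] show ?thesis
    by (simp only: half[OF g0(1,2) k0(1,3)] half[OF k0(1,2) g0(1,3)] g0(3) k0(3) subset_refl atLeastAtMost_borel)
qed

text \<open>With \<open>F = F a + integral g\<close> and \<open>G = G a + integral k\<close> the
  constants contribute linear terms, and the product of the two indefinite integrals is handled by
  \<open>integral_triangle\<close>.\<close>

lemma is_primitive_mult:
  assumes F: "is_primitive a b F g" and G: "is_primitive a b G k"
  shows "is_primitive a b (\<lambda>t. F t * G t) (\<lambda>t. F t * k t + G t * g t)"
  unfolding is_primitive_def
proof (intro conjI ballI)
  note gi = is_primitive_absolutely_integrable[OF F] and ki = is_primitive_absolutely_integrable[OF G]
  show int: "(\<lambda>t. F t * k t + G t * g t) absolutely_integrable_on {a..b}"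
    using absolutely_integrable_continuous_mult[OF is_primitive_continuous[OF F] ki]
      absolutely_integrable_continuous_mult[OF is_primitive_continuous[OF G] gi]
    by (rule set_integral_add)
  fix t assume t: "t \<in> {a..b}"
  then have t': "t \<in> {a..t}" by simp
  have g: "g absolutely_integrable_on {a..t}" and k: "k absolutely_integrable_on {a..t}"
    using gi ki t by (auto intro: absolutely_integrable_on_subinterval)
  have g': "g integrable_on {a..t}" and k': "k integrable_on {a..t}"
    using g k by (auto simp: absolutely_integrable_on_def)
  have gk: "(\<lambda>s. g s * integral {a..s} k) integrable_on {a..t}"
    using absolutely_integrable_continuous_mult[OF indefinite_integral_continuous_1[OF k'] g]
    by (simp add: absolutely_integrable_on_def mult.commute)
  have kg: "(\<lambda>s. k s * integral {a..s} g) integrable_on {a..t}"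
    using absolutely_integrable_continuous_mult[OF indefinite_integral_continuous_1[OF g'] k]
    by (simp add: absolutely_integrable_on_def mult.commute)
  have eqF: "integral {a..s} g = F s - F a" "integral {a..s} k = G s - G a" if "s \<in> {a..t}" for s
    using F G that t by (auto simp: is_primitive_def)
  have "((\<lambda>s. (F a * k s + G a * g s) + (k s * integral {a..s} g + g s * integral {a..s} k)) has_integral
      (F a * integral {a..t} k + G a * integral {a..t} g)
      + (integral {a..t} (\<lambda>s. k s * integral {a..s} g) + integral {a..t} (\<lambda>s. g s * integral {a..s} k))) {a..t}"
    by (intro has_integral_add has_integral_mult_right integrable_integral g' k' gk kg)
  then have "((\<lambda>s. F s * k s + G s * g s) has_integral
      (F a * integral {a..t} k + G a * integral {a..t} g)
      + (integral {a..t} (\<lambda>s. k s * integral {a..s} g) + integral {a..t} (\<lambda>s. g s * integral {a..s} k))) {a..t}"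
    by (rule has_integral_eq[rotated]) (simp add: eqF algebra_simps)
  moreover have "integral {a..t} (\<lambda>s. k s * integral {a..s} g) + integral {a..t} (\<lambda>s. g s * integral {a..s} k)
      = integral {a..t} g * integral {a..t} k"
    using integral_triangle[OF g k] by simp
  ultimately have "integral {a..t} (\<lambda>s. F s * k s + G s * g s) =
      F a * integral {a..t} k + G a * integral {a..t} g + integral {a..t} g * integral {a..t} k"
    by (simp add: integral_unique)
  then show "integral {a..t} (\<lambda>t. F t * k t + G t * g t) = F t * G t - F a * G a"
    by (simp add: eqF[OF t'] algebra_simps)
qed

section \<open>Weak derivatives\<close>

lemma L2_iff:
  "v \<in> L2 a b \<longleftrightarrow> v absolutely_integrable_on {a..b} \<and> (\<lambda>x. (v x)\<^sup>2) absolutely_integrable_on {a..b}"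
proof -
  have "integrable (lebesgue_on {a<..<b}) v"
    if v: "v \<in> borel_measurable (lebesgue_on {a<..<b})" "integrable (lebesgue_on {a<..<b}) (\<lambda>x. (v x)\<^sup>2)"
  proof (rule Bochner_Integration.integrable_bound)
    have "integrable (lebesgue_on {a<..<b}) (\<lambda>x. 1 :: real)"
      using absolutely_integrable_on_const[of "{a..b}" "1::real"]
      by (simp add: absolutely_integrable_on_Icc_iff_integrable)
    then show "integrable (lebesgue_on {a<..<b}) (\<lambda>x. 1 + (v x)\<^sup>2)"
      using v(2) by (rule Bochner_Integration.integrable_add)
    have "\<bar>y\<bar> \<le> 1 + y\<^sup>2" for y :: real
      using zero_le_power2[of "\<bar>y\<bar> - 1"] by (simp add: power2_diff)
    then show "AE x in lebesgue_on {a<..<b}. norm (v x) \<le> norm (1 + (v x)\<^sup>2)"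
      by (auto intro!: AE_I2 order_trans[OF _ abs_ge_self])
  qed (use v in auto)
  then show ?thesis
    unfolding L2_def absolutely_integrable_on_Icc_iff_integrable mem_Collect_eq
    using borel_measurable_integrable[of "lebesgue_on {a<..<b}" v] by blast
qed

lemma L2_AE_cong:
  assumes "v \<in> L2 a b" "AE x in lebesgue_on {a<..<b}. v x = w x"
  shows "w \<in> L2 a b"
proof -
  have "AE x in lebesgue_on {a<..<b}. (v x)\<^sup>2 = (w x)\<^sup>2"
    using assms(2) by eventually_elim simp
  then show ?thesis
    using assms absolutely_integrable_AE_Icc by (fastforce simp: L2_iff)
qed

lemma L2_continuous_mult:
  assumes "continuous_on {a..b} F" "g \<in> L2 a b"
  shows "(\<lambda>t. F t * g t) \<in> L2 a b"
  using assms absolutely_integrable_continuous_mult[of a b F g]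
    absolutely_integrable_continuous_mult[of a b "\<lambda>t. (F t)\<^sup>2" "\<lambda>t. (g t)\<^sup>2"]
  by (simp add: L2_iff power_mult_distrib continuous_on_power)

lemma L2_continuous: "continuous_on {a..b} F \<Longrightarrow> F \<in> L2 a b"
  by (auto simp: L2_iff intro!: absolutely_integrable_continuous_real continuous_intros)

lemma integral_lebesgue_on_Ioo_AE:
  fixes f g :: "real \<Rightarrow> real"
  assumes "f absolutely_integrable_on {a..b}" "AE x in lebesgue_on {a<..<b}. f x = g x"
  shows "integral\<^sup>L (lebesgue_on {a<..<b}) g = integral {a..b} f"
proof -
  have g: "g absolutely_integrable_on {a..b}"
    using assms(2,1) by (rule absolutely_integrable_AE_Icc)
  have "(f has_integral integral {a..b} f) {a..b}"
    using assms(1) by (auto simp: absolutely_integrable_on_def)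
  then have "(g has_integral integral {a..b} f) {a..b}"
    using has_integral_AE_Icc[OF assms(2) order_refl order_refl] by simp
  then show ?thesis
    using integral_lebesgue_on_Ioo[OF g] by (simp add: integral_unique)
qed

lemma L2_norm_eq:
  assumes "v \<in> L2 a b" "AE x in lebesgue_on {a<..<b}. v x = w x"
  shows "L2_norm a b w = sqrt (integral {a..b} (\<lambda>x. (v x)\<^sup>2))"
proof -
  have "AE x in lebesgue_on {a<..<b}. (v x)\<^sup>2 = (w x)\<^sup>2"
    using assms(2) by eventually_elim simp
  with assms(1) show ?thesis
    by (simp add: L2_norm_def L2_iff integral_lebesgue_on_Ioo_AE)
qed

text \<open>The product rule is applied to \<open>F * \<phi>\<close>, which vanishes at both ends
  because \<open>\<phi>\<close> does.\<close>

lemma is_primitive_has_weak_deriv: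
  assumes F: "is_primitive a b F g" and "a < b" and v: "AE x in lebesgue_on {a<..<b}. F x = v x"
  shows "has_weak_deriv a b v g"
  unfolding has_weak_deriv_def
proof (intro allI impI)
  fix \<phi> \<phi>' assume "test_function a b \<phi> \<phi>'"
  then obtain c d where cd: "a < c" "d < b" "\<And>x. x \<notin> {c..d} \<Longrightarrow> \<phi> x = 0"
    and deriv: "\<And>x. (\<phi> has_real_derivative \<phi>' x) (at x)" and cont: "continuous_on UNIV \<phi>'"
    unfolding test_function_def by blast
  have \<phi>': "continuous_on {a..b} \<phi>'"
    using cont by (rule continuous_on_subset) simp
  have \<phi>: "is_primitive a b \<phi> \<phi>'"
    using \<phi>' by (rule is_primitive_deriv[rotated]) (auto intro: has_field_derivative_at_within deriv)
  have 1: "(\<lambda>t. F t * \<phi>' t) absolutely_integrable_on {a..b}"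
    using is_primitive_continuous[OF F] is_primitive_absolutely_integrable[OF \<phi>]
    by (rule absolutely_integrable_continuous_mult)
  have 2: "(\<lambda>t. \<phi> t * g t) absolutely_integrable_on {a..b}"
    using is_primitive_continuous[OF \<phi>] is_primitive_absolutely_integrable[OF F]
    by (rule absolutely_integrable_continuous_mult)
  have "integral {a..b} (\<lambda>t. F t * \<phi>' t + \<phi> t * g t) = 0"
    using is_primitive_integral[OF is_primitive_mult[OF F \<phi>]] cd \<open>a < b\<close> by auto
  moreover have "integral {a..b} (\<lambda>t. F t * \<phi>' t + \<phi> t * g t)
      = integral {a..b} (\<lambda>t. F t * \<phi>' t) + integral {a..b} (\<lambda>t. \<phi> t * g t)"
    using 1 2 by (intro Henstock_Kurzweil_Integration.integral_add absolutely_integrable_on_imp_integrable_on)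
  moreover have "(\<integral>x. v x * \<phi>' x \<partial>lebesgue_on {a<..<b}) = integral {a..b} (\<lambda>t. F t * \<phi>' t)"
    using v by (intro integral_lebesgue_on_Ioo_AE 1) (auto elim: eventually_mono)
  moreover have "(\<integral>x. g x * \<phi> x \<partial>lebesgue_on {a<..<b}) = integral {a..b} (\<lambda>t. \<phi> t * g t)"
    by (intro integral_lebesgue_on_Ioo_AE 2) (auto simp: mult.commute)
  ultimately show "(\<integral>x. v x * \<phi>' x \<partial>lebesgue_on {a<..<b}) = - (\<integral>x. g x * \<phi> x \<partial>lebesgue_on {a<..<b})"
    by simp
qed

section \<open>Trapezoidal cut-offs and the du Bois-Reymond lemma\<close>

definition trapezoid :: "real \<Rightarrow> real \<Rightarrow> real \<Rightarrow> real \<Rightarrow> real" where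
  "trapezoid c d e x = max 0 (1 - (max 0 (c - x) + max 0 (x - d)) / e)"

lemma continuous_trapezoid [continuous_intros]: "e > 0 \<Longrightarrow> continuous_on S (trapezoid c d e)"
  unfolding trapezoid_def by (intro continuous_intros) auto

lemma trapezoid_eq_0: "e > 0 \<Longrightarrow> x \<notin> {c - e..d + e} \<Longrightarrow> trapezoid c d e x = 0"
  by (auto simp: trapezoid_def max_def field_simps)

lemma trapezoid_eq_1: "x \<in> {c..d} \<Longrightarrow> trapezoid c d e x = 1"
  by (simp add: trapezoid_def)

lemma trapezoid_bounds: "e > 0 \<Longrightarrow> 0 \<le> trapezoid c d e x \<and> trapezoid c d e x \<le> 1"
  by (auto simp: trapezoid_def)

text \<open>Outside \<open>[c, d]\<close> the trapezoid falls linearly to 0 over the distance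
  \<open>e\<close>. With the width \<open>e / (k + 1)\<close> it is 0 at a given outer point as soon
  as the width is smaller than the distance from that point to \<open>[c, d]\<close>, so the
  sequence is eventually constant.\<close>

lemma trapezoid_tendsto_indicator:
  assumes "e > 0"
  shows "(\<lambda>k. trapezoid c d (e / real (Suc k)) x) \<longlonglongrightarrow> indicator {c..d} x"
proof (cases "x \<in> {c..d}")
  case True
  then show ?thesis by (simp add: trapezoid_eq_1)
next
  case False
  define r where "r = max (c - x) (x - d)"
  have "r > 0" using False by (auto simp: r_def)
  have "(\<lambda>k. e / real (Suc k)) \<longlonglongrightarrow> 0"
    using tendsto_mult_right_zero[OF LIMSEQ_inverse_real_of_nat, of e] by (simp add: field_simps)
  then have "\<forall>\<^sub>F k in sequentially. e / real (Suc k) < r"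
    using \<open>r > 0\<close> by (rule order_tendstoD)
  then have "\<forall>\<^sub>F k in sequentially. trapezoid c d (e / real (Suc k)) x = indicator {c..d} x"
  proof eventually_elim
    case (elim k)
    have "trapezoid c d (e / real (Suc k)) x = 0"
    proof (rule trapezoid_eq_0)
      show "x \<notin> {c - e / real (Suc k)..d + e / real (Suc k)}"
        using elim by (auto simp: r_def simp del: of_nat_Suc)
    qed (use assms in simp)
    then show ?case using False by simp
  qed
  then show ?thesis by (rule tendsto_eventually)
qed

text \<open>Mean zero is exactly what makes the antiderivative return to 0 on the right of the
  support. Continuity of \<open>\<theta>\<close> suffices, as test functions are only required to be
  of class C^1.\<close>

lemma antiderivative_test_function:
  assumes cont: "continuous_on UNIV \<theta>" and cd: "a < c" "c \<le> d" "d < b"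
    and supp: "\<And>x. x \<notin> {c..d} \<Longrightarrow> \<theta> x = 0" and mean: "integral {a..b} \<theta> = 0"
  shows "test_function a b (\<lambda>x. integral {a..x} \<theta>) \<theta>"
proof -
  have int: "\<theta> integrable_on {x..y}" for x y
    using cont by (intro integrable_continuous_real continuous_on_subset[OF cont]) simp
  have zero: "integral {a..x} \<theta> = 0" if "x \<notin> {c..d}" for x
  proof (cases "x < c")
    case True
    then have "integral {a..x} \<theta> = integral {a..x} (\<lambda>_. 0)"
      using supp by (intro Henstock_Kurzweil_Integration.integral_cong) auto
    then show ?thesis by simp
  next
    case False
    then have "d < x" using that by auto
    have tail: "integral {d..y} \<theta> = 0" for y
    proof -
      have "integral {d..y} \<theta> = integral {d..y} (\<lambda>_. 0)"
        by (rule integral_spike[of "{d}"]) (use supp in auto)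
      then show ?thesis by simp
    qed
    have "integral {a..d} \<theta> + integral {d..y} \<theta> = integral {a..y} \<theta>" if "d \<le> y" for y
      using cd that int by (intro Henstock_Kurzweil_Integration.integral_combine) auto
    then have "integral {a..d} \<theta> = integral {a..y} \<theta>" if "d \<le> y" for y
      using that tail by auto
    from this[of x] this[of b] show ?thesis
      using mean \<open>d < x\<close> cd by auto
  qed
  \<comment> \<open>For \<open>x \<ge> c > a\<close> the point is interior to
    \<open>[a, x + 1]\<close>, so the fundamental theorem gives a two-sided derivative. Left of
    \<open>c\<close>, also beyond \<open>a\<close>, the function is identically 0.\<close>
  have "((\<lambda>x. integral {a..x} \<theta>) has_real_derivative \<theta> x) (at x)" for x
  proof (cases "x < c")
    case True
    have "((\<lambda>x. 0) has_real_derivative 0) (at x)" by simp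
    then have "((\<lambda>x. integral {a..x} \<theta>) has_real_derivative 0) (at x)"
      by (rule has_field_derivative_transform_within_open[of _ _ _ "{..<c}"])
        (use True zero in auto)
    then show ?thesis using supp[of x] True by simp
  next
    case False
    have "((\<lambda>x. integral {a..x} \<theta>) has_real_derivative \<theta> x) (at x within {a..x+1})"
      using False cd by (intro integral_has_real_derivative continuous_on_subset[OF cont]) auto
    then show ?thesis
      using False cd by (simp add: at_within_Icc_at)
  qed
  then show ?thesis
    unfolding test_function_def using cont cd zero by blast
qed

text \<open>By \<open>antiderivative_test_function\<close> the hypothesis covers all continuous
  functions of mean zero with compact support in \<open>(a, b)\<close>. Removing the mean with a
  fixed bump shows that \<open>w - m\<close> is orthogonal to all compactly supported continuous
  functions, and approximating indicators by them gives zero integrals over compact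
  subintervals.\<close>

lemma du_Bois_Reymond:
  assumes w: "w absolutely_integrable_on {a..b}" and "a < b"
    and zero: "\<And>\<phi> \<phi>'. test_function a b \<phi> \<phi>' \<Longrightarrow> integral {a..b} (\<lambda>t. \<phi>' t * w t) = 0"
  obtains m where "AE x in lebesgue_on {a<..<b}. w x = m"
proof -
  \<comment> \<open>The fixed bump has its plateau between the quarter points; ramps of width
    \<open>(b - a) / 8\<close> keep its support inside \<open>(a, b)\<close>.\<close>
  define c0 where "c0 = (3 * a + b) / 4"
  define d0 where "d0 = (a + 3 * b) / 4"
  define e0 where "e0 = (b - a) / 8"
  note defs0 = c0_def d0_def e0_def
  let ?\<psi>0 = "trapezoid c0 d0 e0"
  have e0: "e0 > 0" and ord0: "a < c0 - e0" "c0 < d0" "d0 + e0 < b"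
    using \<open>a < b\<close> by (auto simp: defs0 field_simps)
  have cont0: "continuous_on S ?\<psi>0" for S
    using e0 by (rule continuous_trapezoid)
  define J where "J = integral {a..b} ?\<psi>0"
  have J: "J > 0"
  proof -
    have "d0 - c0 = integral {c0..d0} (\<lambda>_. 1)"
      using ord0 by simp
    also have "\<dots> = integral {c0..d0} ?\<psi>0"
      by (intro Henstock_Kurzweil_Integration.integral_cong) (simp add: trapezoid_eq_1)
    also have "\<dots> \<le> J"
      unfolding J_def using e0 ord0 cont0 trapezoid_bounds
      by (intro integral_subset_le integrable_continuous_real) auto
    finally show ?thesis using ord0 by linarith
  qed
  \<comment> \<open>The mean of \<open>w\<close> weighted by the bump: the only constant for which
    \<open>w - m\<close> is orthogonal to the bump itself.\<close>
  define m where "m = integral {a..b} (\<lambda>t. ?\<psi>0 t * w t) / J"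
  have mw: "(\<lambda>t. w t - m) absolutely_integrable_on {a..b}"
    using w by (intro set_integral_diff) auto
  have prod_int: "(\<lambda>t. \<psi> t * w t) integrable_on {a..b}" if "continuous_on UNIV \<psi>" for \<psi>
    using absolutely_integrable_continuous_mult[OF continuous_on_subset[OF that] w]
    by (simp add: absolutely_integrable_on_def)
  have orth: "integral {a..b} (\<lambda>t. \<psi> t * (w t - m)) = 0"
    if \<psi>: "continuous_on UNIV \<psi>" and cd: "a < c" "d < b" and supp: "\<And>x. x \<notin> {c..d} \<Longrightarrow> \<psi> x = 0"
    for \<psi> c d
  proof -
    define I where "I = integral {a..b} \<psi>"
    \<comment> \<open>\<open>\<psi>\<close> is made mean-free, so that it becomes the derivative of a test function.\<close>
    define r where "r = I / J"
    define \<theta> where "\<theta> t = \<psi> t - r * ?\<psi>0 t" for t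
    have \<psi>i: "\<psi> integrable_on {a..b}" and \<psi>0i: "?\<psi>0 integrable_on {a..b}"
      using continuous_on_subset[OF \<psi>] cont0 by (auto intro: integrable_continuous_real)
    have "integral {a..b} \<theta> = I - r * J"
      unfolding \<theta>_def I_def J_def using \<psi>i \<psi>0i
      by (simp add: Henstock_Kurzweil_Integration.integral_diff integrable_on_mult_right)
    then have "integral {a..b} \<theta> = 0" using J by (simp add: r_def)
    then have "test_function a b (\<lambda>x. integral {a..x} \<theta>) \<theta>"
    proof (rule antiderivative_test_function[of \<theta> a "min c (c0 - e0)" "max d (d0 + e0)" b, rotated -1])
      show "continuous_on UNIV \<theta>"
        unfolding \<theta>_def by (intro continuous_intros \<psi> cont0)
      show "\<theta> x = 0" if "x \<notin> {min c (c0 - e0)..max d (d0 + e0)}" for x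
      proof -
        have "\<psi> x = 0" by (rule supp) (use that in auto)
        moreover have "?\<psi>0 x = 0" by (rule trapezoid_eq_0) (use that e0 in auto)
        ultimately show ?thesis by (simp add: \<theta>_def)
      qed
    qed (use ord0 cd e0 in auto)
    from zero[OF this] have "integral {a..b} (\<lambda>t. \<psi> t * w t - r * (?\<psi>0 t * w t)) = 0"
      by (simp add: \<theta>_def algebra_simps)
    then have "integral {a..b} (\<lambda>t. \<psi> t * w t) = r * integral {a..b} (\<lambda>t. ?\<psi>0 t * w t)"
      using prod_int[OF \<psi>] prod_int[OF cont0]
      by (simp add: Henstock_Kurzweil_Integration.integral_diff integrable_on_mult_right)
    also have "\<dots> = m * I" by (simp add: m_def r_def)
    finally have "integral {a..b} (\<lambda>t. \<psi> t * w t - m * \<psi> t) = 0"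
      using prod_int[OF \<psi>] \<psi>i
      by (simp add: Henstock_Kurzweil_Integration.integral_diff integrable_on_mult_right I_def)
    then show ?thesis by (simp add: algebra_simps)
  qed
  define H where "H t = integral {a..t} (\<lambda>t. w t - m)" for t
  have mwi: "(\<lambda>t. w t - m) integrable_on {a..b}"
    using mw by (rule absolutely_integrable_on_imp_integrable_on)
  have Hcont: "continuous_on {a..b} H"
    unfolding H_def using mwi by (rule indefinite_integral_continuous_1)
  \<comment> \<open>Dominated convergence with majorant \<open>\<bar>w - m\<bar>\<close>. The
    starting width \<open>e\<close> is at most half of each gap to the ends, so all supports lie in
    \<open>[c - e, d + e]\<close> inside \<open>(a, b)\<close>.\<close>
  have sub: "integral {c..d} (\<lambda>t. w t - m) = 0" if cd: "a < c" "c \<le> d" "d < b" for c d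
  proof -
    define e where "e = min (c - a) (b - d) / 2"
    have e: "e > 0" "a < c - e" "d + e < b"
      using cd by (auto simp: e_def min_def field_simps)
    let ?\<psi> = "\<lambda>k. trapezoid c d (e / real (Suc k))"
    have ek: "0 < e / real (Suc k)" "e / real (Suc k) \<le> e" for k
      using e by (auto simp: field_simps)
    have "(\<lambda>k. integral {a..b} (\<lambda>t. ?\<psi> k t * (w t - m))) \<longlonglongrightarrow> integral {a..b} (\<lambda>t. indicator {c..d} t * (w t - m))"
    proof (rule dominated_convergence(2)[where h="\<lambda>t. \<bar>w t - m\<bar>"])
      show "(\<lambda>t. ?\<psi> k t * (w t - m)) integrable_on {a..b}" for k
        by (rule absolutely_integrable_on_imp_integrable_on[OF absolutely_integrable_continuous_mult])
          (use ek mw in \<open>auto intro: continuous_trapezoid\<close>)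
      show "(\<lambda>t. \<bar>w t - m\<bar>) integrable_on {a..b}"
        using mw by (simp add: absolutely_integrable_on_def)
      show "norm (?\<psi> k t * (w t - m)) \<le> \<bar>w t - m\<bar>" for k t
        using trapezoid_bounds[OF ek(1), of c d k t] by (simp add: abs_mult mult_left_le_one_le)
      show "(\<lambda>k. ?\<psi> k t * (w t - m)) \<longlonglongrightarrow> indicator {c..d} t * (w t - m)" for t
        using e by (intro tendsto_intros trapezoid_tendsto_indicator)
    qed
    moreover have "integral {a..b} (\<lambda>t. ?\<psi> k t * (w t - m)) = 0" for k
    proof (rule orth[of _ "c - e" "d + e"])
      show "continuous_on UNIV (?\<psi> k)" using ek(1) by (rule continuous_trapezoid)
      show "?\<psi> k x = 0" if "x \<notin> {c - e..d + e}" for x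
        using that ek[of k] by (intro trapezoid_eq_0) auto
    qed (use e in auto)
    ultimately have "integral {a..b} (\<lambda>t. indicator {c..d} t * (w t - m)) = 0"
      by (simp add: LIMSEQ_const_iff)
    moreover have "integral {a..b} (\<lambda>t. indicator {c..d} t * (w t - m)) = integral {a..b} (\<lambda>t. if t \<in> {c..d} then w t - m else 0)"
      by (intro Henstock_Kurzweil_Integration.integral_cong) auto
    moreover have "\<dots> = integral ({c..d} \<inter> {a..b}) (\<lambda>t. w t - m)"
      by (simp only: integral_restrict_Int)
    moreover have "{c..d} \<inter> {a..b} = {c..d}" using cd by auto
    ultimately show ?thesis by metis
  qed
  have Hconst: "H s = H t" if "s \<le> t" "a < s" "t < b" for s t
  proof -
    have "H s + integral {s..t} (\<lambda>t. w t - m) = H t"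
      unfolding H_def using that mwi
      by (intro Henstock_Kurzweil_Integration.integral_combine) (auto intro: integrable_on_subinterval)
    then show ?thesis using sub[of s t] that by simp
  qed
  define h where "h = (a + b) / 2"
  have h: "a < h" "h < b" using \<open>a < b\<close> by (auto simp: h_def)
  have inner: "H t = H h" if "t \<in> {a<..<b}" for t
  proof (cases "t \<le> h")
    case True
    then show ?thesis using Hconst[of t h] h that by simp
  next
    case False
    then show ?thesis using Hconst[of h t] h that by simp
  qed
  \<comment> \<open>So far \<open>H\<close> is constant only on the open interval; continuity
    extends this to the endpoints, where \<open>H a = 0\<close>.\<close>
  have cl: "closure {a<..<b} = {a..b}" using \<open>a < b\<close> by simp
  have "H t = H h" if "t \<in> {a..b}" for t
    using continuous_constant_on_closure[of "{a<..<b}" H "H h" t] Hcont that inner unfolding cl by simp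
  then have "H t = H a" if "t \<in> {a..b}" for t
    using that \<open>a < b\<close> by simp
  then have "integral {a..t} (\<lambda>t. w t - m) = 0" if "t \<in> {a..b}" for t
    using that by (simp add: H_def)
  from zero_primitive_imp_AE_zero[OF mw this] have "AE x in lebesgue_on {a<..<b}. w x = m"
    by simp
  then show thesis by (rule that)
qed

text \<open>The difference of \<open>v\<close> and the indefinite integral of \<open>g\<close> has
  weak derivative 0, hence is almost everywhere constant by \<open>du_Bois_Reymond\<close>.\<close>

lemma has_weak_deriv_imp_primitive:
  assumes v: "v absolutely_integrable_on {a..b}" and g: "g absolutely_integrable_on {a..b}"
    and wd: "has_weak_deriv a b v g" and "a < b"
  obtains F where "is_primitive a b F g" "AE x in lebesgue_on {a<..<b}. F x = v x"
proof -
  define G where "G t = integral {a..t} g" for t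
  have G: "is_primitive a b G g"
    using g by (simp add: is_primitive_def G_def)
  have Gi: "G absolutely_integrable_on {a..b}"
    using is_primitive_continuous[OF G] by (rule absolutely_integrable_continuous_real)
  have w: "(\<lambda>t. v t - G t) absolutely_integrable_on {a..b}"
    using v Gi by (rule set_integral_diff)
  obtain m where m: "AE x in lebesgue_on {a<..<b}. v x - G x = m"
  proof (rule du_Bois_Reymond[OF w \<open>a < b\<close>])
    fix \<phi> \<phi>' assume t: "test_function a b \<phi> \<phi>'"
    then have \<phi>': "continuous_on {a..b} \<phi>'"
      unfolding test_function_def using continuous_on_subset by blast
    have 1: "(\<lambda>t. \<phi>' t * v t) absolutely_integrable_on {a..b}"
      and 2: "(\<lambda>t. \<phi>' t * G t) absolutely_integrable_on {a..b}"
      using \<phi>' v Gi by (auto intro: absolutely_integrable_continuous_mult)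
    have "has_weak_deriv a b G g"
      using G \<open>a < b\<close> by (rule is_primitive_has_weak_deriv) simp
    then have "(\<integral>x. G x * \<phi>' x \<partial>lebesgue_on {a<..<b}) = (\<integral>x. v x * \<phi>' x \<partial>lebesgue_on {a<..<b})"
      using wd t by (simp add: has_weak_deriv_def)
    then have "integral {a..b} (\<lambda>t. \<phi>' t * G t) = integral {a..b} (\<lambda>t. \<phi>' t * v t)"
      using integral_lebesgue_on_Ioo[OF 1] integral_lebesgue_on_Ioo[OF 2] by (simp add: mult.commute)
    then show "integral {a..b} (\<lambda>t. \<phi>' t * (v t - G t)) = 0"
      using 1 2 by (simp add: right_diff_distrib absolutely_integrable_on_def
        Henstock_Kurzweil_Integration.integral_diff)
  qed
  show thesis
  proof (rule that)
    show "is_primitive a b (\<lambda>t. m + integral {a..t} g) g"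
      using g by (rule is_primitive_indefinite_integral)
    show "AE x in lebesgue_on {a<..<b}. m + integral {a..x} g = v x"
      using m by eventually_elim (simp add: G_def)
  qed
qed

text \<open>A continuous nonnegative function with integral 0 vanishes; here it is
  \<open>\<bar>F t - G t\<bar>\<close>.\<close>

lemma AE_eq_imp_eq_Icc:
  fixes F G :: "real \<Rightarrow> real"
  assumes "continuous_on {a..b} F" "continuous_on {a..b} G" "a < b"
    and ae: "AE x in lebesgue_on {a<..<b}. F x = G x" and t: "t \<in> {a..b}"
  shows "F t = G t"
proof -
  have D: "(\<lambda>t. \<bar>F t - G t\<bar>) absolutely_integrable_on {a..b}"
    using assms by (intro absolutely_integrable_continuous_real continuous_intros)
  have "AE x in lebesgue_on {a<..<b}. \<bar>F x - G x\<bar> = 0"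
    using ae by eventually_elim simp
  then have "((\<lambda>t. \<bar>F t - G t\<bar>) has_integral 0) {a..b}"
    using has_integral_AE_Icc[where f="\<lambda>t. \<bar>F t - G t\<bar>" and g="\<lambda>t. 0" and c=a and d=b and y=0] by auto
  moreover have "continuous_on {a..b} (\<lambda>t. \<bar>F t - G t\<bar>)"
    using assms by (intro continuous_intros)
  ultimately have "\<bar>F t - G t\<bar> = 0"
    using has_integral_0_cbox_imp_0[of a b "\<lambda>t. \<bar>F t - G t\<bar>" t] t \<open>a < b\<close> by simp
  then show ?thesis by simp
qed

text \<open>The primitives belonging to \<open>g\<close> and \<open>k\<close> are continuous and
  both represent \<open>v\<close>, so they coincide everywhere; then \<open>g - k\<close> has a
  vanishing indefinite integral.\<close>

lemma has_weak_deriv_unique: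
  assumes "v absolutely_integrable_on {a..b}" "g absolutely_integrable_on {a..b}" "k absolutely_integrable_on {a..b}"
    and "has_weak_deriv a b v g" "has_weak_deriv a b v k" and "a < b"
  shows "AE x in lebesgue_on {a<..<b}. g x = k x"
proof -
  obtain F where F: "is_primitive a b F g" "AE x in lebesgue_on {a<..<b}. F x = v x"
    using has_weak_deriv_imp_primitive assms by blast
  obtain G where G: "is_primitive a b G k" "AE x in lebesgue_on {a<..<b}. G x = v x"
    using has_weak_deriv_imp_primitive assms by blast
  have "AE x in lebesgue_on {a<..<b}. F x = G x"
    using F(2) G(2) by eventually_elim simp
  then have eq: "F t = G t" if "t \<in> {a..b}" for t
    using AE_eq_imp_eq_Icc[OF is_primitive_continuous[OF F(1)] is_primitive_continuous[OF G(1)] \<open>a < b\<close>] that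
    by blast
  have P: "is_primitive a b (\<lambda>t. F t - G t) (\<lambda>t. g t - k t)"
    using F(1) G(1) by (rule is_primitive_diff)
  have "AE x in lebesgue_on {a<..<b}. g x - k x = 0"
  proof (rule zero_primitive_imp_AE_zero[OF is_primitive_absolutely_integrable[OF P]])
    show "integral {a..t} (\<lambda>t. g t - k t) = 0" if "t \<in> {a..b}" for t
      using P that eq[OF that] eq[of a] by (simp add: is_primitive_def)
  qed
  then show ?thesis by simp
qed

section \<open>Passage between \<open>H1\<close> and indefinite integrals\<close>

lemma weak_deriv_H1:
  assumes "v \<in> H1 a b"
  shows "weak_deriv a b v \<in> L2 a b" "has_weak_deriv a b v (weak_deriv a b v)"
proof -
  have "\<exists>g. g \<in> L2 a b \<and> has_weak_deriv a b v g"
    using assms by (auto simp: H1_def)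
  from someI_ex[OF this] show "weak_deriv a b v \<in> L2 a b" "has_weak_deriv a b v (weak_deriv a b v)"
    by (auto simp: weak_deriv_def)
qed

lemma H1_imp_primitive:
  assumes "v \<in> H1 a b" "a < b"
  obtains F where "is_primitive a b F (weak_deriv a b v)" "AE x in lebesgue_on {a<..<b}. F x = v x"
  using has_weak_deriv_imp_primitive[OF _ _ weak_deriv_H1(2)[OF assms(1)] assms(2)] weak_deriv_H1(1)[OF assms(1)] assms
  by (auto simp: L2_iff H1_def)

text \<open>Identifies the representative chosen in \<open>weak_deriv\<close> with an explicit
  derivative, so that norms and energies can be computed from the latter.\<close>

lemma primitive_imp_H1:
  assumes F: "is_primitive a b F g" and g: "g \<in> L2 a b" and "a < b"
    and v: "AE x in lebesgue_on {a<..<b}. F x = v x"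
  shows "v \<in> H1 a b" "AE x in lebesgue_on {a<..<b}. g x = weak_deriv a b v x"
proof -
  have vL2: "v \<in> L2 a b"
    using L2_continuous[OF is_primitive_continuous[OF F]] v by (rule L2_AE_cong)
  have wd: "has_weak_deriv a b v g"
    using F \<open>a < b\<close> v by (rule is_primitive_has_weak_deriv)
  show H1: "v \<in> H1 a b"
    using vL2 wd g by (auto simp: H1_def)
  show "AE x in lebesgue_on {a<..<b}. g x = weak_deriv a b v x"
    using vL2 g wd weak_deriv_H1[OF H1] \<open>a < b\<close>
    by (intro has_weak_deriv_unique[where v=v]) (auto simp: L2_iff)
qed

section \<open>Estimates on a single element\<close>

lemma L2_cmult: "v \<in> L2 a b \<Longrightarrow> (\<lambda>t. c * v t) \<in> L2 a b"
  using L2_continuous_mult[of a b "\<lambda>t. c" v] by simp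

lemma L2_mult_absolutely_integrable:
  assumes "v \<in> L2 a b" "w \<in> L2 a b"
  shows "(\<lambda>t. v t * w t) absolutely_integrable_on {a..b}"
proof (rule measurable_bounded_by_integrable_imp_absolutely_integrable)
  show "(\<lambda>t. v t * w t) \<in> borel_measurable (lebesgue_on {a..b})"
    using assms by (intro borel_measurable_times absolutely_integrable_imp_borel_measurable) (auto simp: L2_iff)
  show "(\<lambda>t. (v t)\<^sup>2 + (w t)\<^sup>2) integrable_on {a..b}"
    using assms by (intro integrable_add absolutely_integrable_on_imp_integrable_on) (auto simp: L2_iff)
  fix t
  have "2 * \<bar>v t * w t\<bar> \<le> (v t)\<^sup>2 + (w t)\<^sup>2"
    using zero_le_power2[of "\<bar>v t\<bar> - \<bar>w t\<bar>"] by (simp add: power2_diff abs_mult)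
  then show "norm (v t * w t) \<le> (v t)\<^sup>2 + (w t)\<^sup>2" by simp
qed simp

lemma L2_add:
  assumes "v \<in> L2 a b" "w \<in> L2 a b"
  shows "(\<lambda>t. v t + w t) \<in> L2 a b"
proof -
  have "(\<lambda>t. (v t)\<^sup>2 + (w t)\<^sup>2 + 2 * (v t * w t)) absolutely_integrable_on {a..b}"
    using assms L2_mult_absolutely_integrable[OF assms] by (intro set_integral_add set_integrable_mult_right) (auto simp: L2_iff)
  then show ?thesis
    using assms by (simp add: L2_iff power2_sum algebra_simps)
qed

lemma L2_diff: "v \<in> L2 a b \<Longrightarrow> w \<in> L2 a b \<Longrightarrow> (\<lambda>t. v t - w t) \<in> L2 a b"
  using L2_add[of v a b "\<lambda>t. -1 * w t"] L2_cmult[of w a b "-1"] by simp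

lemma L2_sum:
  assumes "finite I" "\<And>i. i \<in> I \<Longrightarrow> v i \<in> L2 a b"
  shows "(\<lambda>t. \<Sum>i\<in>I. v i t) \<in> L2 a b"
  using assms by (induction I rule: finite_induct) (auto intro: L2_continuous L2_add)

lemma L2_subinterval: "v \<in> L2 a b \<Longrightarrow> a \<le> c \<Longrightarrow> d \<le> b \<Longrightarrow> v \<in> L2 c d"
  by (auto simp: L2_iff intro: absolutely_integrable_on_subinterval)

section \<open>Cauchy-Schwarz, Poincare and mean-value bounds\<close>

lemma integral_square_nonneg:
  fixes v :: "real \<Rightarrow> real"
  shows "v \<in> L2 a b \<Longrightarrow> 0 \<le> integral {a..b} (\<lambda>t. (v t)\<^sup>2)"
  by (auto simp: L2_iff absolutely_integrable_on_def intro!: Henstock_Kurzweil_Integration.integral_nonneg)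

text \<open>Cauchy-Schwarz against the constant 1, obtained by integrating the nonnegative function
  \<open>(g - m)^2\<close> with \<open>m\<close> the mean of \<open>g\<close>.\<close>

lemma integral_power2_le:
  assumes g: "g \<in> L2 s t" and "s \<le> t"
  shows "(integral {s..t} g)\<^sup>2 \<le> (t - s) * integral {s..t} (\<lambda>x. (g x)\<^sup>2)"
proof (cases "s = t")
  case False
  define I where "I = integral {s..t} g"
  define m where "m = I / (t - s)"
  have st: "t - s > 0" using False assms by simp
  have "((\<lambda>x. (g x)\<^sup>2 - 2 * m * g x + m\<^sup>2) has_integral integral {s..t} (\<lambda>x. (g x)\<^sup>2) - 2 * m * I + (t - s) * m\<^sup>2) {s..t}"
    using g has_integral_const_real[of "m\<^sup>2" s t] \<open>s \<le> t\<close> unfolding I_def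
    by (intro has_integral_add has_integral_diff has_integral_mult_right integrable_integral)
      (auto simp: L2_iff absolutely_integrable_on_def)
  then have "0 \<le> integral {s..t} (\<lambda>x. (g x)\<^sup>2) - 2 * m * I + (t - s) * m\<^sup>2"
  proof (rule has_integral_nonneg)
    show "0 \<le> (g x)\<^sup>2 - 2 * m * g x + m\<^sup>2" for x
      using zero_le_power2[of "g x - m"] by (simp add: power2_diff algebra_simps)
  qed
  also have "\<dots> = integral {s..t} (\<lambda>x. (g x)\<^sup>2) - I\<^sup>2 / (t - s)"
  proof -
    have "(t - s) * m = I" using st by (simp add: m_def)
    then have "(t - s) * m\<^sup>2 = m * I" by (metis mult.assoc mult.commute power2_eq_square)
    moreover have "m * I = I\<^sup>2 / (t - s)" by (simp add: m_def power2_eq_square)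
    ultimately show ?thesis by simp
  qed
  finally have "I\<^sup>2 / (t - s) \<le> integral {s..t} (\<lambda>x. (g x)\<^sup>2)" by simp
  then show ?thesis
    using st by (simp add: I_def pos_divide_le_eq mult.commute)
qed simp

text \<open>Hoelder continuity of order 1/2, with the bound enlarged from \<open>[s, t]\<close> to
  the whole interval so that it is uniform in both points.\<close>

lemma primitive_diff_power2_le:
  assumes P: "is_primitive c d F g" and g: "g \<in> L2 c d" and st: "s \<in> {c..d}" "t \<in> {c..d}"
  shows "(F t - F s)\<^sup>2 \<le> (d - c) * integral {c..d} (\<lambda>x. (g x)\<^sup>2)"
proof -
  have main: "(F t - F s)\<^sup>2 \<le> (d - c) * integral {c..d} (\<lambda>x. (g x)\<^sup>2)" if "c \<le> s" "s \<le> t" "t \<le> d" for s t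
  proof -
    have "(F t - F s)\<^sup>2 \<le> (t - s) * integral {s..t} (\<lambda>x. (g x)\<^sup>2)"
      using integral_power2_le[OF L2_subinterval[OF g that(1,3)] that(2)] is_primitive_diff_eq[OF P that] by simp
    also have "\<dots> \<le> (d - c) * integral {c..d} (\<lambda>x. (g x)\<^sup>2)"
    proof (rule mult_mono)
      show "integral {s..t} (\<lambda>x. (g x)\<^sup>2) \<le> integral {c..d} (\<lambda>x. (g x)\<^sup>2)"
        using g L2_subinterval[OF g that(1,3)] that
        by (intro integral_subset_le) (auto simp: L2_iff absolutely_integrable_on_def)
      show "0 \<le> integral {s..t} (\<lambda>x. (g x)\<^sup>2)"
        using L2_subinterval[OF g that(1,3)] by (rule integral_square_nonneg)
    qed (use that in auto)
    finally show ?thesis .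
  qed
  show ?thesis
    using main[of s t] main[of t s] st by (cases "s \<le> t") (auto simp: power2_commute)
qed

lemma Poincare_interval:
  assumes P: "is_primitive c d F g" and g: "g \<in> L2 c d" and "c \<le> d" and zero: "F c = 0"
  shows "integral {c..d} (\<lambda>t. (F t)\<^sup>2) \<le> (d - c)\<^sup>2 * integral {c..d} (\<lambda>x. (g x)\<^sup>2)"
proof -
  have "integral {c..d} (\<lambda>t. (F t)\<^sup>2) \<le> integral {c..d} (\<lambda>t. (d - c) * integral {c..d} (\<lambda>x. (g x)\<^sup>2))"
  proof (rule integral_le)
    show "(\<lambda>t. (F t)\<^sup>2) integrable_on {c..d}"
      using is_primitive_continuous[OF P] by (intro integrable_continuous_real continuous_intros)
    show "(F t)\<^sup>2 \<le> (d - c) * integral {c..d} (\<lambda>x. (g x)\<^sup>2)" if "t \<in> {c..d}" for t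
      using primitive_diff_power2_le[OF P g _ that, of c] zero \<open>c \<le> d\<close> by simp
  qed (rule integrable_const_ivl)
  then show ?thesis
    using \<open>c \<le> d\<close> by (simp add: power2_eq_square algebra_simps)
qed

text \<open>Since \<open>r\<close> has mean zero, \<open>(d - c) * r t\<close> is the integral of
  \<open>r t - r s\<close> over \<open>s\<close>.\<close>

lemma mean_zero_bound:
  fixes r :: "real \<Rightarrow> real"
  assumes "c < d" and r: "continuous_on {c..d} r" and mean: "integral {c..d} r = 0"
    and osc: "\<And>s. s \<in> {c..d} \<Longrightarrow> \<bar>r t - r s\<bar> \<le> B"
  shows "\<bar>r t\<bar> \<le> B"
proof -
  have ri: "r integrable_on {c..d}" using r by (rule integrable_continuous_real)
  have hi: "((\<lambda>s. r t - r s) has_integral (d - c) * r t - 0) {c..d}"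
    using has_integral_diff[OF has_integral_const_real[of "r t" c d] integrable_integral[OF ri]] mean \<open>c < d\<close> by simp
  have "B \<ge> 0"
    using order_trans[OF abs_ge_zero osc[of c]] \<open>c < d\<close> by simp
  then have "norm ((d - c) * r t - 0) \<le> B * measure lborel {c..d}"
    using hi osc \<open>c < d\<close> osc[of c] by (intro has_integral_bound_real[where S="{}" and f="\<lambda>s. r t - r s"]) auto
  then have "(d - c) * \<bar>r t\<bar> \<le> (d - c) * B"
    using \<open>c < d\<close> by (simp add: abs_mult mult.commute)
  then show ?thesis using \<open>c < d\<close> by simp
qed

lemma power2_add_le: "(x + y)\<^sup>2 \<le> 2 * x\<^sup>2 + 2 * y\<^sup>2" for x y :: real
  using sum_squares_bound[of x y] by (simp add: power2_sum)

text \<open>To be used with \<open>p = u'\<close>, \<open>\<sigma>\<close> the slope of the finite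
  element solution, and \<open>F\<close> the continuous representative of \<open>f\<close>; then
  \<open>W\<close> is the derivative of the corrected error, and \<open>mean\<close> says that
  \<open>u\<close> and the finite element solution have the same increment over the element.
  \<open>W\<close> is split into a part \<open>r\<close> with \<open>F\<close> frozen at
  \<open>c\<close>, a part with \<open>F t - F c\<close>, and the bubble times \<open>g\<close>;
  each has L2 size of order \<open>(d - c)^2\<close> times the norm of \<open>g\<close>.\<close>

lemma element_estimate:
  assumes "c < d" and "\<beta> > 0"
    and p: "is_primitive c d p (\<lambda>t. - F t / \<beta>)" and F: "is_primitive c d F g" and g: "g \<in> L2 c d"
    and mean: "integral {c..d} p = \<sigma> * (d - c)"
    and W: "\<And>t. t \<in> {c<..<d} \<Longrightarrow> W t = p t - \<sigma> + ((2 * t - c - d) * F t + (t - c) * (t - d) * g t) / (2 * \<beta>)"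
    and Wi: "W absolutely_integrable_on {c..d}"
  shows "W \<in> L2 c d"
    and "integral {c..d} (\<lambda>t. (W t)\<^sup>2) \<le> 5 / \<beta>\<^sup>2 * (d - c) ^ 4 * integral {c..d} (\<lambda>t. (g t)\<^sup>2)"
proof -
  define h where "h = d - c"
  define N where "N = integral {c..d} (\<lambda>t. (g t)\<^sup>2)"
  \<comment> \<open>A bound for the oscillation of \<open>F\<close> on the element, by Hoelder
    continuity.\<close>
  define D where "D = sqrt (h * N)"
  have h: "h > 0" using \<open>c < d\<close> by (simp add: h_def)
  have N: "N \<ge> 0" unfolding N_def using g by (rule integral_square_nonneg)
  have D: "D \<ge> 0" "D\<^sup>2 = h * N" using h N by (auto simp: D_def)
  have osc: "\<bar>F t - F s\<bar> \<le> D" if "s \<in> {c..d}" "t \<in> {c..d}" for s t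
    unfolding D_def h_def N_def using primitive_diff_power2_le[OF F g that]
    by (intro real_le_rsqrt) simp
  \<comment> \<open>The derivative of the corrected error if the correction used the constant
    \<open>F c\<close>. Its own derivative \<open>(F c - F t) / \<beta>\<close> is small, so
    \<open>r\<close> has small oscillation.\<close>
  define r where "r t = p t - \<sigma> + (2 * t - c - d) * F c / (2 * \<beta>)" for t
  have lin: "is_primitive c d (\<lambda>t. (2 * t - c - d) * F c / (2 * \<beta>) - \<sigma>) (\<lambda>t. F c / \<beta>)"
    by (rule is_primitive_deriv) (use \<open>\<beta> > 0\<close> in \<open>auto intro!: derivative_eq_intros continuous_intros\<close>)
  have rP: "is_primitive c d r (\<lambda>t. - F t / \<beta> + F c / \<beta>)"
    using is_primitive_add[OF p lin] by (rule is_primitive_cong) (auto simp: r_def)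
  \<comment> \<open>\<open>2 * t - c - d\<close> is odd about the midpoint and integrates to 0. Only
    \<open>- \<sigma>\<close> remains, which cancels the mean of \<open>p\<close>; so
    \<open>r\<close> has mean zero and is bounded by its oscillation.\<close>
  have lin0: "((\<lambda>t. (2 * t - c - d) * F c / (2 * \<beta>) - \<sigma>) has_integral - \<sigma> * (d - c)) {c..d}"
  proof -
    have "((\<lambda>t. (2 * t - c - d) * F c / (2 * \<beta>) - \<sigma>) has_integral
        ((d\<^sup>2 - c * d - d * d) * F c / (2 * \<beta>) - \<sigma> * d) - ((c\<^sup>2 - c * c - d * c) * F c / (2 * \<beta>) - \<sigma> * c)) {c..d}"
      using \<open>c < d\<close> \<open>\<beta> > 0\<close> by (intro fundamental_theorem_of_calculus)
        (auto simp flip: has_real_derivative_iff_has_vector_derivative intro!: derivative_eq_intros)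
    then show ?thesis by (simp add: power2_eq_square algebra_simps)
  qed
  have pi: "p integrable_on {c..d}"
    using is_primitive_continuous[OF p] by (rule integrable_continuous_real)
  have "(r has_integral integral {c..d} p + - \<sigma> * (d - c)) {c..d}"
    by (rule has_integral_eq[OF _ has_integral_add[OF integrable_integral[OF pi] lin0]]) (simp add: r_def)
  then have r_mean: "integral {c..d} r = 0"
    using mean by (simp add: integral_unique)
  have r_osc: "\<bar>r t - r s\<bar> \<le> h * D / \<beta>" if st: "s \<in> {c..d}" "t \<in> {c..d}" for s t
  proof -
    have main: "\<bar>r t - r s\<bar> \<le> h * D / \<beta>" if "c \<le> s" "s \<le> t" "t \<le> d" for s t
    proof -
      have "((\<lambda>t. - F t / \<beta> + F c / \<beta>) has_integral r t - r s) {s..t}"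
        using is_primitive_diff_eq[OF rP that] is_primitive_integrable[OF is_primitive_subinterval[OF rP that(1,3)]]
        by (simp add: has_integral_integrable_integral)
      moreover have "norm (- F x / \<beta> + F c / \<beta>) \<le> D / \<beta>" if "x \<in> {s..t}" for x
      proof -
        have "- F x / \<beta> + F c / \<beta> = (F c - F x) / \<beta>" by (simp add: diff_divide_distrib)
        then show ?thesis
          using osc[of x c] that \<open>c \<le> s\<close> \<open>t \<le> d\<close> \<open>c < d\<close> \<open>\<beta> > 0\<close> by (simp add: abs_divide divide_right_mono)
      qed
      ultimately have "norm (r t - r s) \<le> D / \<beta> * measure lborel {s..t}"
        using D \<open>\<beta> > 0\<close> by (intro has_integral_bound_real[where S="{}" and f="\<lambda>t. - F t / \<beta> + F c / \<beta>"]) auto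
      also have "\<dots> \<le> D / \<beta> * h"
        using that D \<open>\<beta> > 0\<close> by (intro mult_left_mono) (auto simp: h_def)
      finally show ?thesis by (simp add: mult.commute)
    qed
    show ?thesis
      using main[of s t] main[of t s] st by (cases "s \<le> t") (auto simp: abs_minus_commute)
  qed
  have r_bound: "\<bar>r t\<bar> \<le> h * D / \<beta>" if "t \<in> {c..d}" for t
    using mean_zero_bound[OF \<open>c < d\<close> is_primitive_continuous[OF rP] r_mean] r_osc that by blast
  \<comment> \<open>The terms without \<open>g\<close> are bounded by \<open>h * D / \<beta>\<close>
    from \<open>r\<close> and half of that from \<open>F t - F c\<close>, together 3/2; squaring and
    doubling gives 9/2. The bubble is bounded by \<open>h * h\<close>, and its denominator
    \<open>2 * \<beta>\<close> leads to the factor 1/2.\<close>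
  have W2: "(W t)\<^sup>2 \<le> (9 / 2 * h\<^sup>2 * D\<^sup>2 + h ^ 4 / 2 * (g t)\<^sup>2) / \<beta>\<^sup>2" if t: "t \<in> {c<..<d}" for t
  proof -
    let ?A = "r t + (2 * t - c - d) * (F t - F c) / (2 * \<beta>)" and ?B = "(t - c) * (t - d) * g t / (2 * \<beta>)"
    have "W t = ?A + ?B"
      unfolding W[OF t] r_def using \<open>\<beta> > 0\<close> by (simp add: field_simps)
    have "\<bar>(2 * t - c - d) * (F t - F c)\<bar> \<le> h * D"
      unfolding abs_mult by (rule mult_mono) (use t osc[of c t] D in \<open>auto simp: h_def\<close>)
    then have "\<bar>(2 * t - c - d) * (F t - F c) / (2 * \<beta>)\<bar> \<le> h * D / (2 * \<beta>)"
      unfolding abs_divide using \<open>\<beta> > 0\<close> by (simp add: divide_right_mono)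
    moreover have "\<bar>r t\<bar> \<le> h * D / \<beta>"
      using t by (intro r_bound) simp
    ultimately have "\<bar>?A\<bar> \<le> h * D / \<beta> + h * D / (2 * \<beta>)"
      by (intro order_trans[OF abs_triangle_ineq add_mono])
    also have "\<dots> = 3 / 2 * (h * D) / \<beta>" using \<open>\<beta> > 0\<close> by (simp add: field_simps)
    finally have "?A\<^sup>2 \<le> (3 / 2 * (h * D) / \<beta>)\<^sup>2"
      using abs_le_square_iff power2_abs by (metis abs_ge_zero power_mono)
    moreover have "?B\<^sup>2 \<le> (h * h * \<bar>g t\<bar> / (2 * \<beta>))\<^sup>2"
    proof -
      have "\<bar>(t - c) * (t - d)\<bar> \<le> h * h"
        unfolding abs_mult by (rule mult_mono) (use t in \<open>auto simp: h_def\<close>)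
      then have "\<bar>?B\<bar> \<le> h * h * \<bar>g t\<bar> / (2 * \<beta>)"
        using \<open>\<beta> > 0\<close> by (simp add: abs_mult abs_divide divide_right_mono mult_right_mono)
      then show ?thesis
        by (metis abs_ge_zero power2_abs power_mono)
    qed
    moreover have "(?A + ?B)\<^sup>2 \<le> 2 * ?A\<^sup>2 + 2 * ?B\<^sup>2"
      by (rule power2_add_le)
    ultimately have "(W t)\<^sup>2 \<le> 2 * (3 / 2 * (h * D) / \<beta>)\<^sup>2 + 2 * (h * h * \<bar>g t\<bar> / (2 * \<beta>))\<^sup>2"
      unfolding \<open>W t = ?A + ?B\<close>
      by (meson add_mono mult_left_mono order_trans zero_le_numeral)
    also have "\<dots> = (9 / 2 * h\<^sup>2 * D\<^sup>2 + h ^ 4 / 2 * (g t)\<^sup>2) / \<beta>\<^sup>2"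
      using \<open>\<beta> > 0\<close> by (simp add: power_mult_distrib power_divide field_simps power2_eq_square power4_eq_xxxx)
    finally show ?thesis .
  qed
  have gi: "(\<lambda>t. (g t)\<^sup>2) integrable_on {c..d}"
    using g by (simp add: L2_iff absolutely_integrable_on_def)
  let ?U = "\<lambda>t. (9 / 2 * h\<^sup>2 * D\<^sup>2 + h ^ 4 / 2 * (g t)\<^sup>2) / \<beta>\<^sup>2"
  have U: "(?U has_integral (9 / 2 * h\<^sup>2 * D\<^sup>2 * h + h ^ 4 / 2 * N) / \<beta>\<^sup>2) {c..d}"
    using has_integral_const_real[of "9 / 2 * h\<^sup>2 * D\<^sup>2" c d] \<open>c < d\<close> unfolding N_def
    by (intro has_integral_divide has_integral_add has_integral_mult_right integrable_integral gi)
      (simp add: h_def mult.commute)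
  \<comment> \<open>The formula for \<open>W\<close> is available only inside the element, so
    integrability and the estimate are shown on the open interval.\<close>
  have "(\<lambda>t. (W t)\<^sup>2) absolutely_integrable_on {c<..<d}"
  proof (rule measurable_bounded_by_integrable_imp_absolutely_integrable)
    show "(\<lambda>t. (W t)\<^sup>2) \<in> borel_measurable (lebesgue_on {c<..<d})"
      using Wi unfolding absolutely_integrable_on_Icc_iff_Ioo
      by (intro borel_measurable_power absolutely_integrable_imp_borel_measurable) auto
    show "?U integrable_on {c<..<d}"
      using U unfolding has_integral_Icc_iff_Ioo by blast
    show "norm ((W t)\<^sup>2) \<le> ?U t" if "t \<in> {c<..<d}" for t
      using W2[OF that] by simp
  qed simp
  then have W2i: "(\<lambda>t. (W t)\<^sup>2) absolutely_integrable_on {c..d}"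
    by (simp only: absolutely_integrable_on_Icc_iff_Ioo)
  then show "W \<in> L2 c d"
    using Wi by (simp add: L2_iff)
  have "integral {c..d} (\<lambda>t. (W t)\<^sup>2) \<le> integral {c..d} ?U"
    unfolding integral_open_interval_real
  proof (rule integral_le)
    show "(\<lambda>t. (W t)\<^sup>2) integrable_on {c<..<d}"
      using W2i unfolding absolutely_integrable_on_Icc_iff_Ioo
      by (rule absolutely_integrable_on_imp_integrable_on)
    show "?U integrable_on {c<..<d}"
      using U unfolding has_integral_Icc_iff_Ioo by blast
  qed (rule W2)
  also have "\<dots> = (9 / 2 * h\<^sup>2 * (h * N) * h + h ^ 4 / 2 * N) / \<beta>\<^sup>2"
    using integral_unique[OF U] by (simp only: D(2))
  \<comment> \<open>Besides the square of \<open>h\<close> from \<open>W2\<close>, the first summand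
    receives one \<open>h\<close> from \<open>D\<close> squared and one from the length of the
    element; then 9/2 + 1/2 = 5.\<close>
  also have "\<dots> = 5 / \<beta>\<^sup>2 * h ^ 4 * N"
    using \<open>\<beta> > 0\<close> by (simp add: field_simps power2_eq_square power4_eq_xxxx)
  finally show "integral {c..d} (\<lambda>t. (W t)\<^sup>2) \<le> 5 / \<beta>\<^sup>2 * (d - c) ^ 4 * integral {c..d} (\<lambda>t. (g t)\<^sup>2)"
    by (simp add: h_def N_def)
qed

section \<open>Meshes and hat functions\<close>

text \<open>For \<open>l < r\<close> it rises linearly from 0 to 1 over \<open>[l, r]\<close>. Hat
  functions are differences of ramps and bubbles are products of them, so breakpoints have to be
  treated only here.\<close>

definition ramp :: "real \<Rightarrow> real \<Rightarrow> real \<Rightarrow> real" where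
  "ramp l r t = max 0 (min 1 ((t - l) / (r - l)))"

definition ramp_deriv :: "real \<Rightarrow> real \<Rightarrow> real \<Rightarrow> real" where
  "ramp_deriv l r t = (if l < t \<and> t < r then 1 / (r - l) else 0)"

lemma ramp_left: "l < r \<Longrightarrow> t \<le> l \<Longrightarrow> ramp l r t = 0"
  by (simp add: ramp_def max_def min_def field_simps)

lemma ramp_right: "l < r \<Longrightarrow> r \<le> t \<Longrightarrow> ramp l r t = 1"
  by (simp add: ramp_def max_def min_def field_simps)

lemma ramp_mid: "l < r \<Longrightarrow> l \<le> t \<Longrightarrow> t \<le> r \<Longrightarrow> ramp l r t = (t - l) / (r - l)"
  by (simp add: ramp_def max_def min_def field_simps)

lemma has_integral_ramp_deriv:
  assumes "l < r" "a \<le> b"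
  shows "(ramp_deriv l r has_integral ramp l r b - ramp l r a) {a..b}"
proof (rule fundamental_theorem_of_calculus_interior_strong[where S="{l, r}"])
  show "continuous_on {a..b} (ramp l r)"
    unfolding ramp_def using assms by (intro continuous_intros) auto
  fix t assume "t \<in> {a<..<b} - {l, r}"
  then consider "t < l" | "l < t" "t < r" | "r < t" by fastforce
  then have "(ramp l r has_real_derivative ramp_deriv l r t) (at t)"
  proof cases
    case 1
    have "((\<lambda>t. 0) has_real_derivative ramp_deriv l r t) (at t)"
      using 1 by (simp add: ramp_deriv_def)
    then show ?thesis
      by (rule has_field_derivative_transform_within_open[of _ _ _ "{..<l}"])
        (use 1 assms in \<open>auto simp: ramp_left\<close>)
  next
    case 2
    have "((\<lambda>t. (t - l) / (r - l)) has_real_derivative ramp_deriv l r t) (at t)"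
      using 2 by (auto simp: ramp_deriv_def intro!: derivative_eq_intros)
    then show ?thesis
      by (rule has_field_derivative_transform_within_open[of _ _ _ "{l<..<r}"])
        (use 2 assms in \<open>auto simp: ramp_mid\<close>)
  next
    case 3
    have "((\<lambda>t. 1) has_real_derivative ramp_deriv l r t) (at t)"
      using 3 by (simp add: ramp_deriv_def)
    then show ?thesis
      by (rule has_field_derivative_transform_within_open[of _ _ _ "{r<..}"])
        (use 3 assms in \<open>auto simp: ramp_right\<close>)
  qed
  then show "(ramp l r has_vector_derivative ramp_deriv l r t) (at t)"
    by (simp add: has_real_derivative_iff_has_vector_derivative)
qed (use assms in auto)

lemma is_primitive_ramp:
  assumes "l < r"
  shows "is_primitive a b (ramp l r) (ramp_deriv l r)"
  unfolding is_primitive_def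
proof (intro conjI ballI)
  show "ramp_deriv l r absolutely_integrable_on {a..b}"
  proof (cases "a \<le> b")
    case True
    show ?thesis
      using has_integral_ramp_deriv[OF assms True] assms
      by (intro nonnegative_absolutely_integrable_1) (auto simp: ramp_deriv_def)
  qed (simp add: set_integrable_def)
  show "integral {a..t} (ramp_deriv l r) = ramp l r t - ramp l r a" if "t \<in> {a..b}" for t
    using has_integral_ramp_deriv[OF assms, of a t] that by (simp add: integral_unique)
qed

lemma ramp_deriv_L2:
  assumes "l < r"
  shows "ramp_deriv l r \<in> L2 a b"
proof -
  have "(\<lambda>t. (ramp_deriv l r t)\<^sup>2) = (\<lambda>t. 1 / (r - l) * ramp_deriv l r t)"
    by (auto simp: ramp_deriv_def power2_eq_square)
  moreover have "(\<lambda>t. 1 / (r - l) * ramp_deriv l r t) absolutely_integrable_on {a..b}"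
    using is_primitive_absolutely_integrable[OF is_primitive_ramp[OF assms]] by (rule set_integrable_mult_right)
  ultimately show ?thesis
    using is_primitive_absolutely_integrable[OF is_primitive_ramp[OF assms]] by (simp only: L2_iff)
qed

text \<open>Because the derivative of a ramp is constant on \<open>(l, r)\<close> and 0 elsewhere,
  only the values of \<open>e\<close> at the two breakpoints survive. Nodal exactness rests on
  this.\<close>

lemma integral_mult_ramp_deriv:
  assumes e: "is_primitive a b e e'" and lr: "a \<le> l" "l < r" "r \<le> b"
  shows "integral {a..b} (\<lambda>t. e' t * ramp_deriv l r t) = (e r - e l) / (r - l)"
proof -
  have "integral {a..b} (\<lambda>t. e' t * ramp_deriv l r t)
      = integral {a..b} (\<lambda>t. if t \<in> {l<..<r} then e' t * (1 / (r - l)) else 0)"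
    by (intro Henstock_Kurzweil_Integration.integral_cong) (simp add: ramp_deriv_def)
  also have "\<dots> = integral {l<..<r} (\<lambda>t. e' t * (1 / (r - l)))"
    unfolding integral_restrict_Int using lr by (intro arg_cong2[where f=integral]) auto
  also have "\<dots> = integral {l..r} e' * (1 / (r - l))"
    by (simp add: integral_open_interval_real)
  also have "integral {l..r} e' = e r - e l"
    using is_primitive_diff_eq[OF e lr(1) _ lr(3)] lr(2) by simp
  finally show ?thesis by simp
qed

section \<open>Mesh geometry and summation over the elements\<close>

lemma mesh_less:
  assumes "mesh xl xr n x" "i < j" "j \<le> n"
  shows "x i < x j"
  using assms(2,3)
proof (induction j)
  case (Suc j)
  have "x j < x (Suc j)" using assms(1) Suc.prems by (simp add: mesh_def)
  then show ?case using Suc by (cases "i = j") auto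
qed simp

lemma mesh_le: "mesh xl xr n x \<Longrightarrow> i \<le> j \<Longrightarrow> j \<le> n \<Longrightarrow> x i \<le> x j"
  using mesh_less[of xl xr n x i j] by (cases "i = j") auto

lemma mesh_bounds: "mesh xl xr n x \<Longrightarrow> i \<le> n \<Longrightarrow> xl \<le> x i \<and> x i \<le> xr"
  using mesh_le[of xl xr n x 0 i] mesh_le[of xl xr n x i n] by (auto simp: mesh_def)

lemma mesh_element_unique:
  assumes "mesh xl xr n x" "i < n" "k < n" "x k < t" "t < x (Suc k)"
  shows "x i < t \<and> t < x (Suc i) \<longleftrightarrow> i = k"
  using assms mesh_le[OF assms(1), of "Suc i" k] mesh_le[OF assms(1), of "Suc k" i]
  by (cases i k rule: linorder_cases) auto

lemma mesh_size_ge: "i < n \<Longrightarrow> x (Suc i) - x i \<le> mesh_size n x"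
  unfolding mesh_size_def by (rule order_trans[OF abs_ge_self Max_ge]) auto

text \<open>The upper bound allows a surplus power of the mesh size to be absorbed into a
  constant.\<close>

lemma mesh_size_bounds:
  assumes "mesh xl xr n x"
  shows "0 < mesh_size n x" "mesh_size n x \<le> xr - xl"
proof -
  have n: "0 < n" and "x 0 < x (Suc 0)" using assms by (auto simp: mesh_def)
  then show "0 < mesh_size n x" using mesh_size_ge[OF n, of x] by simp
  show "mesh_size n x \<le> xr - xl"
    unfolding mesh_size_def
  proof (rule Max.boundedI)
    fix h assume "h \<in> (\<lambda>i. \<bar>x (Suc i) - x i\<bar>) ` {..<n}"
    then obtain i where "i < n" "h = \<bar>x (Suc i) - x i\<bar>" by auto
    then show "h \<le> xr - xl"
      using mesh_bounds[OF assms, of i] mesh_bounds[OF assms, of "Suc i"] mesh_less[OF assms, of i "Suc i"] by simp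
  qed (use n in auto)
qed

text \<open>Integrability is required only on each element and is obtained for the whole interval.
  This matters for the derivative of the corrected error, whose square is first known to be
  integrable element by element.\<close>

lemma integral_mesh_sum:
  fixes g :: "real \<Rightarrow> real"
  assumes "mesh xl xr n x" and int: "\<And>k. k < n \<Longrightarrow> g integrable_on {x k..x (Suc k)}"
  shows "(g has_integral (\<Sum>k<n. integral {x k..x (Suc k)} g)) {xl..xr}"
proof -
  have "(g has_integral (\<Sum>k<m. integral {x k..x (Suc k)} g)) {x 0..x m}" if "m \<le> n" for m
    using that
  proof (induction m)
    case (Suc m)
    have "(g has_integral (\<Sum>k<m. integral {x k..x (Suc k)} g) + integral {x m..x (Suc m)} g) {x 0..x (Suc m)}"
    proof (rule has_integral_combine)
      show "(g has_integral integral {x m..x (Suc m)} g) {x m..x (Suc m)}"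
        using int[of m] Suc.prems by (simp add: integrable_integral)
    qed (use Suc mesh_le[OF assms(1), of 0 m] mesh_le[OF assms(1), of m "Suc m"] in auto)
    then show ?case by simp
  qed (simp add: has_integral_refl)
  from this[of n] show ?thesis using assms(1) by (simp add: mesh_def)
qed

section \<open>Hat functions as differences of ramps\<close>

definition hat_deriv :: "nat \<Rightarrow> (nat \<Rightarrow> real) \<Rightarrow> nat \<Rightarrow> real \<Rightarrow> real" where
  "hat_deriv n x i t = (if 0 < i then ramp_deriv (x (i - 1)) (x i) t else 0)
     - (if i < n then ramp_deriv (x i) (x (Suc i)) t else 0)"

text \<open>Up along the left ramp, down along the right one. At the first node the rising ramp is
  replaced by the constant 1, which is correct only inside the interval: left of \<open>x 0\<close>
  the hat function is 0.\<close>

lemma hat_eq_ramps: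
  assumes m: "mesh xl xr n x" and "i \<le> n" and t: "t \<in> {xl..xr}"
  shows "hat n x i t = (if 0 < i then ramp (x (i - 1)) (x i) t else 1)
     - (if i < n then ramp (x i) (x (Suc i)) t else 0)"
proof -
  have l: "x (i - 1) < x i" if "0 < i" using mesh_less[OF m, of "i - 1" i] \<open>i \<le> n\<close> that by simp
  have r: "x i < x (Suc i)" if "i < n" using mesh_less[OF m, of i "Suc i"] that by simp
  have ends: "x 0 \<le> t" "t \<le> x n" using m t by (auto simp: mesh_def)
  consider "t < x i" | "t = x i" | "x i < t" by linarith
  then show ?thesis
  proof cases
    case 1
    then have "0 < i" using ends by (cases i) auto
    moreover have "i < n \<Longrightarrow> ramp (x i) (x (Suc i)) t = 0" using 1 r by (simp add: ramp_left)
    ultimately show ?thesis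
      using 1 l by (cases "x (i - 1) \<le> t") (auto simp: hat_def ramp_mid ramp_left)
  next
    case 2
    moreover have "0 < n" using m by (simp add: mesh_def)
    ultimately show ?thesis using l r \<open>i \<le> n\<close> by (cases "0 < i") (auto simp: hat_def ramp_left ramp_right)
  next
    case 3
    then have "i < n" using ends \<open>i \<le> n\<close> by (cases "i = n") auto
    moreover have "0 < i \<Longrightarrow> ramp (x (i - 1)) (x i) t = 1" using 3 l by (simp add: ramp_right)
    ultimately show ?thesis
      using 3 r by (cases "t \<le> x (Suc i)") (auto simp: hat_def ramp_mid ramp_right field_simps)
  qed
qed

lemma hat_node:
  assumes m: "mesh xl xr n x" and "i \<le> n" "j \<le> n"
  shows "hat n x i (x j) = (if i = j then 1 else 0)"
proof -
  have l: "x (i - 1) < x i" if "0 < i" using mesh_less[OF m, of "i - 1" i] \<open>i \<le> n\<close> that by simp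
  have r: "x i < x (Suc i)" if "i < n" using mesh_less[OF m, of i "Suc i"] that by simp
  have "x j \<in> {xl..xr}" using mesh_bounds[OF m \<open>j \<le> n\<close>] by simp
  note eq = hat_eq_ramps[OF m \<open>i \<le> n\<close> this]
  consider "j < i" | "i = j" | "i < j" by linarith
  then show ?thesis
  proof cases
    case 1
    then have "x j \<le> x (i - 1)" using mesh_le[OF m, of j "i - 1"] \<open>i \<le> n\<close> by simp
    moreover have "0 < i" using 1 by simp
    ultimately show ?thesis unfolding eq using 1 l r by (auto simp: ramp_left)
  next
    case 2
    then show ?thesis unfolding eq using l r by (auto simp: ramp_left ramp_right)
  next
    case 3
    then have "x (Suc i) \<le> x j" using mesh_le[OF m, of "Suc i" j] \<open>j \<le> n\<close> by simp
    moreover have "i < n" using 3 \<open>j \<le> n\<close> by simp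
    ultimately show ?thesis unfolding eq using 3 l r by (auto simp: ramp_right)
  qed
qed

lemma is_primitive_hat:
  assumes m: "mesh xl xr n x" and "i \<le> n"
  shows "is_primitive xl xr (hat n x i) (hat_deriv n x i)"
proof -
  have "is_primitive xl xr (\<lambda>t. if 0 < i then ramp (x (i - 1)) (x i) t else 1)
      (\<lambda>t. if 0 < i then ramp_deriv (x (i - 1)) (x i) t else 0)"
    using mesh_less[OF m, of "i - 1" i] \<open>i \<le> n\<close> is_primitive_ramp is_primitive_const by (cases "0 < i") auto
  moreover have "is_primitive xl xr (\<lambda>t. if i < n then ramp (x i) (x (Suc i)) t else 0)
      (\<lambda>t. if i < n then ramp_deriv (x i) (x (Suc i)) t else 0)"
    using mesh_less[OF m, of i "Suc i"] is_primitive_ramp is_primitive_const by (cases "i < n") auto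
  ultimately show ?thesis
    by (rule is_primitive_cong[OF is_primitive_diff]) (auto simp: hat_eq_ramps[OF m \<open>i \<le> n\<close>] hat_deriv_def)
qed

lemma hat_deriv_L2:
  assumes m: "mesh xl xr n x" and "i \<le> n"
  shows "hat_deriv n x i \<in> L2 a b"
proof -
  have 0: "(\<lambda>t. 0) \<in> L2 a b" by (rule L2_continuous) simp
  have "(\<lambda>t. if 0 < i then ramp_deriv (x (i - 1)) (x i) t else 0) \<in> L2 a b"
    using mesh_less[OF m, of "i - 1" i] \<open>i \<le> n\<close> ramp_deriv_L2 0 by (cases "0 < i") auto
  moreover have "(\<lambda>t. if i < n then ramp_deriv (x i) (x (Suc i)) t else 0) \<in> L2 a b"
    using mesh_less[OF m, of i "Suc i"] ramp_deriv_L2 0 by (cases "i < n") auto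
  ultimately show ?thesis
    using L2_diff by (fastforce simp: hat_deriv_def[abs_def])
qed

lemma hat_deriv_element:
  assumes m: "mesh xl xr n x" and "i \<le> n" "k < n"
    and "x k < t" "t < x (Suc k)" "x k < s" "s < x (Suc k)"
  shows "hat_deriv n x i t = hat_deriv n x i s"
proof -
  have "ramp_deriv (x j) (x (Suc j)) t = ramp_deriv (x j) (x (Suc j)) s" if "j < n" for j
    using mesh_element_unique[OF m that \<open>k < n\<close>] assms by (simp add: ramp_deriv_def)
  from this[of i] this[of "i - 1"] show ?thesis
    using \<open>i \<le> n\<close> by (auto simp: hat_deriv_def)
qed

lemma integral_mult_hat_deriv:
  assumes m: "mesh xl xr n x" and "i \<le> n" and e: "is_primitive xl xr e e'" and e': "e' \<in> L2 xl xr"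
  shows "integral {xl..xr} (\<lambda>t. e' t * hat_deriv n x i t)
    = (if 0 < i then (e (x i) - e (x (i - 1))) / (x i - x (i - 1)) else 0)
      - (if i < n then (e (x (Suc i)) - e (x i)) / (x (Suc i) - x i) else 0)"
proof -
  \<comment> \<open>The guard \<open>P\<close> covers the end nodes, where one of the two ramps is
    absent.\<close>
  have *: "(\<lambda>t. e' t * (if P then ramp_deriv (x j) (x k) t else 0)) integrable_on {xl..xr} \<and>
    integral {xl..xr} (\<lambda>t. e' t * (if P then ramp_deriv (x j) (x k) t else 0))
    = (if P then (e (x k) - e (x j)) / (x k - x j) else 0)"
    if "P \<Longrightarrow> j < k" "P \<Longrightarrow> k \<le> n" for j k P
  proof (cases P)
    case True
    have "x j < x k" using mesh_less[OF m] that True by simp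
    moreover have "xl \<le> x j" "x k \<le> xr" using mesh_bounds[OF m] that True by auto
    ultimately show ?thesis
      using True integral_mult_ramp_deriv[OF e] L2_mult_absolutely_integrable[OF e' ramp_deriv_L2]
      by (simp add: absolutely_integrable_on_imp_integrable_on)
  qed (simp add: integrable_0)
  show ?thesis
    using *[of "0 < i" "i - 1" i] *[of "i < n" i "Suc i"] \<open>i \<le> n\<close>
    by (simp add: hat_deriv_def right_diff_distrib Henstock_Kurzweil_Integration.integral_diff)
qed

section \<open>The boundary value problem and nodal exactness\<close>

text \<open>The boundary condition solved for the derivative; \<open>valid_bc\<close> permits the
  division in the Robin case.\<close>

lemma satisfies_bc_flux:
  assumes "satisfies_bc bc v v'" "valid_bc bc" "\<not> is_Dirichlet bc"
  shows "v' = bc_load bc - bc_coeff bc * v"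
  using assms by (cases bc) (auto simp: field_simps)

text \<open>\<open>E\<close> and \<open>s\<close> are the boundary value and the slope of a function
  satisfying the homogeneous boundary condition; adding it preserves the inhomogeneous one.\<close>

lemma satisfies_bc_add:
  assumes "satisfies_bc bc v v'" "valid_bc bc"
    and "if is_Dirichlet bc then E = 0 else s = - bc_coeff bc * E"
  shows "satisfies_bc bc (v + E) (v' + s)"
  using assms by (cases bc) (auto simp: field_simps)

text \<open>The indefinite integrals representing \<open>u\<close> and its weak derivative are
  continuous, as are \<open>u\<close> and \<open>p\<close>, so they agree at every point. From here
  on the solution is handled without \<open>weak_deriv\<close>.\<close>

lemma bvp_solution_imp_primitives:
  assumes bvp: "bvp_solution xl xr \<beta> bl br f u" and "xl < xr" "\<beta> > 0"
  obtains p where "is_primitive xl xr u p" "is_primitive xl xr p (\<lambda>t. - f t / \<beta>)"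
    "satisfies_bc bl (u xl) (p xl)" "satisfies_bc br (u xr) (p xr)"
proof -
  let ?D = "weak_deriv xl xr"
  obtain p where p: "continuous_on {xl..xr} p" "AE x in lebesgue_on {xl<..<xr}. p x = ?D u x"
    and bc: "satisfies_bc bl (u xl) (p xl)" "satisfies_bc br (u xr) (p xr)"
    using bvp by (auto simp: bvp_solution_def)
  have H: "u \<in> H1 xl xr" "?D u \<in> H1 xl xr" and u: "continuous_on {xl..xr} u"
    and ode: "AE x in lebesgue_on {xl<..<xr}. - \<beta> * ?D (?D u) x = f x"
    using bvp by (auto simp: bvp_solution_def H2_def)
  obtain U where U: "is_primitive xl xr U (?D u)" "AE x in lebesgue_on {xl<..<xr}. U x = u x"
    using H1_imp_primitive[OF H(1) \<open>xl < xr\<close>] .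
  have Uu: "u t = U t" if "t \<in> {xl..xr}" for t
    using AE_eq_imp_eq_Icc[OF is_primitive_continuous[OF U(1)] u \<open>xl < xr\<close> U(2) that] by simp
  obtain Q where Q: "is_primitive xl xr Q (?D (?D u))" "AE x in lebesgue_on {xl<..<xr}. Q x = ?D u x"
    using H1_imp_primitive[OF H(2) \<open>xl < xr\<close>] .
  have "AE x in lebesgue_on {xl<..<xr}. Q x = p x"
    using Q(2) p(2) by eventually_elim simp
  then have Qp: "p t = Q t" if "t \<in> {xl..xr}" for t
    using AE_eq_imp_eq_Icc[OF is_primitive_continuous[OF Q(1)] p(1) \<open>xl < xr\<close> _ that] by simp
  show thesis
  proof (rule that)
    show "is_primitive xl xr u p"
      using U(1) Uu by (rule is_primitive_cong) (use p(2) in \<open>auto elim: eventually_mono\<close>)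
    have "AE x in lebesgue_on {xl<..<xr}. ?D (?D u) x = - f x / \<beta>"
      using ode by eventually_elim (use \<open>\<beta> > 0\<close> in \<open>simp add: field_simps\<close>)
    with Q(1) Qp show "is_primitive xl xr p (\<lambda>t. - f t / \<beta>)"
      by (rule is_primitive_cong)
  qed (fact bc)+
qed

text \<open>The converse direction, needed to show that a modified function is again a solution so
  that uniqueness applies.\<close>

lemma primitives_imp_bvp_solution:
  assumes v: "is_primitive xl xr v q" and q: "is_primitive xl xr q (\<lambda>t. - f t / \<beta>)"
    and f: "f \<in> L2 xl xr" and "xl < xr" "\<beta> > 0"
    and bc: "satisfies_bc bl (v xl) (q xl)" "satisfies_bc br (v xr) (q xr)"
  shows "bvp_solution xl xr \<beta> bl br f v"
proof -
  let ?D = "weak_deriv xl xr"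
  have qL2: "q \<in> L2 xl xr" using is_primitive_continuous[OF q] by (rule L2_continuous)
  have v1: "v \<in> H1 xl xr" "AE x in lebesgue_on {xl<..<xr}. q x = ?D v x"
    using primitive_imp_H1[OF v qL2 \<open>xl < xr\<close>] by auto
  have "(\<lambda>t. - f t / \<beta>) \<in> L2 xl xr"
    using L2_cmult[OF f, of "- 1 / \<beta>"] by simp
  from primitive_imp_H1[OF q this \<open>xl < xr\<close> v1(2)]
  have v2: "?D v \<in> H1 xl xr" "AE x in lebesgue_on {xl<..<xr}. - f x / \<beta> = ?D (?D v) x"
    by auto
  have "AE x in lebesgue_on {xl<..<xr}. - \<beta> * ?D (?D v) x = f x"
    using v2(2) by eventually_elim (use \<open>\<beta> > 0\<close> in \<open>simp add: field_simps\<close>)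
  then show ?thesis
    using v1 v2(1) bc is_primitive_continuous[OF v] is_primitive_continuous[OF q]
    by (auto simp: bvp_solution_def H2_def)
qed

section \<open>The finite element solution, the energy form and nodal exactness\<close>

lemma fem_solution_primitive:
  assumes fem: "fem_solution xl xr \<beta> bl br f n x uh" and m: "mesh xl xr n x"
  obtains uh' \<sigma> where "is_primitive xl xr uh uh'" "uh' \<in> L2 xl xr"
    "\<And>k t. k < n \<Longrightarrow> x k < t \<Longrightarrow> t < x (Suc k) \<Longrightarrow> uh' t = \<sigma> k"
proof -
  obtain c where c: "\<And>t. t \<in> {xl..xr} \<Longrightarrow> uh t = (\<Sum>i\<le>n. c i * hat n x i t)"
    using fem by (auto simp: fem_solution_def)
  show thesis
  proof (rule that)
    have "is_primitive xl xr (\<lambda>t. \<Sum>i\<le>n. c i * hat n x i t) (\<lambda>t. \<Sum>i\<le>n. c i * hat_deriv n x i t)"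
      using m by (intro is_primitive_sum is_primitive_cmult is_primitive_hat) auto
    then show "is_primitive xl xr uh (\<lambda>t. \<Sum>i\<le>n. c i * hat_deriv n x i t)"
      by (rule is_primitive_cong) (auto simp: c)
    show "(\<lambda>t. \<Sum>i\<le>n. c i * hat_deriv n x i t) \<in> L2 xl xr"
      using m by (intro L2_sum L2_cmult hat_deriv_L2) auto
    \<comment> \<open>The slope on an element is read off at its midpoint.\<close>
    show "(\<Sum>i\<le>n. c i * hat_deriv n x i t) = (\<Sum>i\<le>n. c i * hat_deriv n x i ((x k + x (Suc k)) / 2))"
      if "k < n" "x k < t" "t < x (Suc k)" for k t
    proof (rule sum.cong[OF refl])
      fix i assume "i \<in> {..n}"
      then have "hat_deriv n x i t = hat_deriv n x i ((x k + x (Suc k)) / 2)"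
        using that by (intro hat_deriv_element[OF m]) auto
      then show "c i * hat_deriv n x i t = c i * hat_deriv n x i ((x k + x (Suc k)) / 2)"
        by simp
    qed
  qed
qed

text \<open>The integral sees \<open>v\<close> and \<open>w\<close> only up to null sets and may use
  the representatives \<open>V\<close> and \<open>W\<close>, but the boundary terms contain the
  point values of \<open>v\<close> and \<open>w\<close> themselves.\<close>

lemma bilin_form_eq:
  assumes v: "AE t in lebesgue_on {xl<..<xr}. V t = v t" "is_primitive xl xr V v'" "v' \<in> L2 xl xr"
    and w: "AE t in lebesgue_on {xl<..<xr}. W t = w t" "is_primitive xl xr W w'" "w' \<in> L2 xl xr"
    and "xl < xr"
  shows "bilin_form xl xr \<beta> bl br v w = \<beta> * integral {xl..xr} (\<lambda>t. v' t * w' t)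
    + \<beta> * bc_coeff br * v xr * w xr - \<beta> * bc_coeff bl * v xl * w xl"
proof -
  have ae: "AE t in lebesgue_on {xl<..<xr}. v' t = weak_deriv xl xr v t"
    "AE t in lebesgue_on {xl<..<xr}. w' t = weak_deriv xl xr w t"
    using primitive_imp_H1(2)[OF v(2,3) \<open>xl < xr\<close> v(1)] primitive_imp_H1(2)[OF w(2,3) \<open>xl < xr\<close> w(1)] .
  have int: "(\<lambda>t. \<beta> * (v' t * w' t)) absolutely_integrable_on {xl..xr}"
    using L2_mult_absolutely_integrable[OF v(3) w(3)] by (rule set_integrable_mult_right)
  have "AE t in lebesgue_on {xl<..<xr}. \<beta> * (v' t * w' t) = \<beta> * weak_deriv xl xr v t * weak_deriv xl xr w t"
    using ae by eventually_elim simp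
  from integral_lebesgue_on_Ioo_AE[OF int this] show ?thesis
    by (simp add: bilin_form_def)
qed

lemma fem_nodal_exactness:
  assumes "xl < xr" "\<beta> > 0" and val: "valid_bc bl" "valid_bc br" and f: "f \<in> L2 xl xr"
    and bvp: "bvp_solution xl xr \<beta> bl br f u"
    and unique: "\<And>v. bvp_solution xl xr \<beta> bl br f v \<Longrightarrow> \<forall>t\<in>{xl..xr}. v t = u t"
    and m: "mesh xl xr n x" and fem: "fem_solution xl xr \<beta> bl br f n x uh" and "k \<le> n"
  shows "uh (x k) = u (x k)"
proof -
  obtain p where u: "is_primitive xl xr u p" and p: "is_primitive xl xr p (\<lambda>t. - f t / \<beta>)"
    and bc: "satisfies_bc bl (u xl) (p xl)" "satisfies_bc br (u xr) (p xr)"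
    using bvp_solution_imp_primitives[OF bvp \<open>xl < xr\<close> \<open>\<beta> > 0\<close>] .
  obtain uh' \<sigma> where uh: "is_primitive xl xr uh uh'" "uh' \<in> L2 xl xr"
    using fem_solution_primitive[OF fem m] by metis
  have n: "n \<ge> 1" "x 0 = xl" "x n = xr" using m by (auto simp: mesh_def)
  define e where "e t = u t - uh t" for t
  \<comment> \<open>The divided difference of the error on the element to the left of node
    \<open>i\<close>. For \<open>i = 0\<close> truncated subtraction gives the default 0 / 0 = 0,
    which the conditionals below exclude.\<close>
  define s where "s i = (e (x i) - e (x (i - 1))) / (x i - x (i - 1))" for i
  have pL2: "p \<in> L2 xl xr" using is_primitive_continuous[OF p] by (rule L2_continuous)
  have e: "is_primitive xl xr e (\<lambda>t. p t - uh' t)"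
    using is_primitive_diff[OF u uh(1)] by (simp add: e_def[abs_def])
  \<comment> \<open>The discrete equation at a free node is compared with the differential equation
    tested by the same hat function. At an interior node the two neighbouring slopes balance; at a
    free end node a single slope is balanced by the Robin term.\<close>
  have slopes: "(if 0 < i then s i else 0) - (if i < n then s (Suc i) else 0)
      = (if i = 0 then bc_coeff bl * e xl else 0) - (if i = n then bc_coeff br * e xr else 0)"
    if i: "i \<in> free_nodes bl br n" for i
  proof -
    have "i \<le> n" using i by (simp add: free_nodes_def)
    let ?h = "hat n x i" and ?h' = "hat_deriv n x i"
    note h = is_primitive_hat[OF m \<open>i \<le> n\<close>] and h' = hat_deriv_L2[OF m \<open>i \<le> n\<close>, of xl xr]
    have ph: "(\<lambda>t. p t * ?h' t) absolutely_integrable_on {xl..xr}" and uhh: "(\<lambda>t. uh' t * ?h' t) absolutely_integrable_on {xl..xr}"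
      using L2_mult_absolutely_integrable pL2 uh(2) h' by auto
    have fh: "(\<lambda>t. ?h t * f t) absolutely_integrable_on {xl..xr}"
      using is_primitive_continuous[OF h] f by (intro absolutely_integrable_continuous_mult) (auto simp: L2_iff)
    have h_ends: "?h xl = (if i = 0 then 1 else 0)" "?h xr = (if i = n then 1 else 0)"
      using hat_node[OF m \<open>i \<le> n\<close>, of 0] hat_node[OF m \<open>i \<le> n\<close>, of n] n by auto
    \<comment> \<open>Integration by parts of the differential equation against the hat function, as
      the product rule for \<open>p\<close> and \<open>?h\<close>.\<close>
    have "integral {xl..xr} (\<lambda>t. p t * ?h' t + ?h t * (- f t / \<beta>)) = p xr * ?h xr - p xl * ?h xl"
      using is_primitive_integral[OF is_primitive_mult[OF p h]] \<open>xl < xr\<close> by simp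
    moreover have "integral {xl..xr} (\<lambda>t. p t * ?h' t + ?h t * (- f t / \<beta>))
        = integral {xl..xr} (\<lambda>t. p t * ?h' t - 1 / \<beta> * (?h t * f t))"
      by (intro Henstock_Kurzweil_Integration.integral_cong) simp
    moreover have "\<dots> = integral {xl..xr} (\<lambda>t. p t * ?h' t) - 1 / \<beta> * integral {xl..xr} (\<lambda>t. ?h t * f t)"
      using ph fh by (subst Henstock_Kurzweil_Integration.integral_diff)
        (auto intro!: integrable_on_mult_right absolutely_integrable_on_imp_integrable_on)
    ultimately have parts: "integral {xl..xr} (\<lambda>t. p t * ?h' t) - 1 / \<beta> * integral {xl..xr} (\<lambda>t. ?h t * f t)
        = p xr * ?h xr - p xl * ?h xl" by simp
    have "bilin_form xl xr \<beta> bl br uh ?h = load_form xl xr \<beta> bl br f ?h"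
      using fem i by (simp add: fem_solution_def)
    moreover have "bilin_form xl xr \<beta> bl br uh ?h = \<beta> * integral {xl..xr} (\<lambda>t. uh' t * ?h' t)
        + \<beta> * bc_coeff br * uh xr * ?h xr - \<beta> * bc_coeff bl * uh xl * ?h xl"
      using uh h h' \<open>xl < xr\<close> by (intro bilin_form_eq) auto
    moreover have "load_form xl xr \<beta> bl br f ?h = integral {xl..xr} (\<lambda>t. ?h t * f t)
        + \<beta> * bc_load br * ?h xr - \<beta> * bc_load bl * ?h xl"
      using integral_lebesgue_on_Ioo[OF fh] by (simp add: load_form_def mult.commute)
    ultimately have "integral {xl..xr} (\<lambda>t. ?h t * f t) = \<beta> * (integral {xl..xr} (\<lambda>t. uh' t * ?h' t)
        + bc_coeff br * uh xr * ?h xr - bc_coeff bl * uh xl * ?h xl - bc_load br * ?h xr + bc_load bl * ?h xl)"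
      by (simp add: algebra_simps)
    then have "1 / \<beta> * integral {xl..xr} (\<lambda>t. ?h t * f t) = integral {xl..xr} (\<lambda>t. uh' t * ?h' t)
        + bc_coeff br * uh xr * ?h xr - bc_coeff bl * uh xl * ?h xl - bc_load br * ?h xr + bc_load bl * ?h xl"
      using \<open>\<beta> > 0\<close> by simp
    moreover have "integral {xl..xr} (\<lambda>t. (p t - uh' t) * ?h' t)
        = integral {xl..xr} (\<lambda>t. p t * ?h' t) - integral {xl..xr} (\<lambda>t. uh' t * ?h' t)"
      using ph uhh by (simp add: left_diff_distrib Henstock_Kurzweil_Integration.integral_diff
        absolutely_integrable_on_imp_integrable_on)
    ultimately have "integral {xl..xr} (\<lambda>t. (p t - uh' t) * ?h' t)
        = (p xr + bc_coeff br * uh xr - bc_load br) * ?h xr - (p xl + bc_coeff bl * uh xl - bc_load bl) * ?h xl"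
      using parts by (simp add: algebra_simps)
    \<comment> \<open>At a free end node the boundary condition expresses \<open>p\<close> through
      \<open>u\<close>, which turns flux, coefficient and load terms into a multiple of the error.
      At other nodes the hat function vanishes at that end.\<close>
    also have "\<dots> = (if i = 0 then bc_coeff bl * e xl else 0) - (if i = n then bc_coeff br * e xr else 0)"
    proof -
      have "p xl + bc_coeff bl * uh xl - bc_load bl = - bc_coeff bl * e xl" if "i = 0"
        using satisfies_bc_flux[OF bc(1) val(1)] i that by (auto simp: free_nodes_def e_def algebra_simps)
      moreover have "p xr + bc_coeff br * uh xr - bc_load br = - bc_coeff br * e xr" if "i = n"
        using satisfies_bc_flux[OF bc(2) val(2)] i that by (auto simp: free_nodes_def e_def algebra_simps)
      ultimately show ?thesis using n by (auto simp: h_ends)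
    qed
    finally show ?thesis
      using integral_mult_hat_deriv[OF m \<open>i \<le> n\<close> e L2_diff[OF pL2 uh(2)]] by (simp only: s_def diff_Suc_1)
  qed
  \<comment> \<open>Every interior node is free and contributes \<open>s i = s (Suc i)\<close>.
    Equal slopes put the nodal errors on a straight line.\<close>
  have slope_const: "s i = s 1" if "1 \<le> i" "i \<le> n" for i
    using that
  proof (induction i rule: dec_induct)
    case (step i)
    then have "i \<in> free_nodes bl br n" by (auto simp: free_nodes_def)
    from slopes[OF this] step show ?case by simp
  qed simp
  have linear: "e (x i) = e xl + s 1 * (x i - xl)" if "i \<le> n" for i
    using that
  proof (induction i)
    case 0
    then show ?case using n by simp
  next
    case (Suc i)
    have "x i < x (Suc i)" using mesh_less[OF m, of i "Suc i"] Suc by simp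
    then have "e (x (Suc i)) = e (x i) + s (Suc i) * (x (Suc i) - x i)"
      by (simp add: s_def)
    then show ?case
      using Suc slope_const[of "Suc i"] by (simp add: algebra_simps)
  qed
  have bcl: "if is_Dirichlet bl then e xl = 0 else s 1 = - bc_coeff bl * e xl"
  proof (cases "is_Dirichlet bl")
    case True
    then obtain g where "bl = Dirichlet g" by (cases bl) auto
    then show ?thesis using bc fem by (simp add: e_def fem_solution_def)
  next
    case False
    then have "0 \<in> free_nodes bl br n" using n by (simp add: free_nodes_def)
    from slopes[OF this] show ?thesis using False n by auto
  qed
  have bcr: "if is_Dirichlet br then e xr = 0 else s 1 = - bc_coeff br * e xr"
  proof (cases "is_Dirichlet br")
    case True
    then obtain g where "br = Dirichlet g" by (cases br) auto
    then show ?thesis using bc fem by (simp add: e_def fem_solution_def)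
  next
    case False
    then have "n \<in> free_nodes bl br n" using n by (simp add: free_nodes_def)
    from slopes[OF this] show ?thesis using False n slope_const[of n] by auto
  qed
  \<comment> \<open>\<open>u\<close> plus the linear function through the nodal errors, which by
    \<open>bcl\<close> and \<open>bcr\<close> satisfies the homogeneous boundary conditions. So
    \<open>v\<close> is another solution, and uniqueness forces the linear function to
    vanish.\<close>
  define v where "v t = u t + (e xl + s 1 * (t - xl))" for t
  have "bvp_solution xl xr \<beta> bl br f v"
  proof (rule primitives_imp_bvp_solution[where q="\<lambda>t. p t + s 1"])
    have "is_primitive xl xr (\<lambda>t. e xl + s 1 * (t - xl)) (\<lambda>t. s 1)"
      by (rule is_primitive_deriv) (auto intro!: derivative_eq_intros)
    from is_primitive_add[OF u this] show "is_primitive xl xr v (\<lambda>t. p t + s 1)"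
      by (simp add: v_def[abs_def])
    from is_primitive_add[OF p is_primitive_const] show "is_primitive xl xr (\<lambda>t. p t + s 1) (\<lambda>t. - f t / \<beta>)"
      by simp
    show "satisfies_bc bl (v xl) (p xl + s 1)"
      using satisfies_bc_add[OF bc(1) val(1) bcl] by (simp add: v_def)
    have "v xr = u xr + e xr" using linear[of n] n by (simp add: v_def)
    then show "satisfies_bc br (v xr) (p xr + s 1)"
      using satisfies_bc_add[OF bc(2) val(2) bcr] by simp
  qed fact+
  from unique[OF this] have "v (x k) = u (x k)"
    using mesh_bounds[OF m \<open>k \<le> n\<close>] by simp
  then have "e (x k) = 0" using linear[OF \<open>k \<le> n\<close>] by (simp add: v_def)
  then show ?thesis by (simp add: e_def)
qed

section \<open>The corrected solution\<close>

definition bubble :: "nat \<Rightarrow> (nat \<Rightarrow> real) \<Rightarrow> real \<Rightarrow> real" where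
  "bubble n x t = (\<Sum>k<n. if x k < t \<and> t < x (Suc k) then (t - x k) * (t - x (Suc k)) else 0)"

definition bubble_deriv :: "nat \<Rightarrow> (nat \<Rightarrow> real) \<Rightarrow> real \<Rightarrow> real" where
  "bubble_deriv n x t = (\<Sum>k<n. if x k < t \<and> t < x (Suc k) then 2 * t - x k - x (Suc k) else 0)"

lemma u_new_bubble: "u_new \<beta> f n x uh t = uh t - bubble n x t / (2 * \<beta>) * f t"
proof -
  have "(\<Sum>k<n. if x k < t \<and> t < x (Suc k) then 1 / (2 * \<beta>) * (t - x k) * (t - x (Suc k)) * f t else 0)
      = bubble n x t * (1 / (2 * \<beta>) * f t)"
    unfolding bubble_def sum_distrib_right by (intro sum.cong) auto
  then show ?thesis by (simp add: u_new_def)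
qed

text \<open>On an element \<open>[l, r]\<close> the bubble equals
  \<open>- (r - l)^2 * \<rho> * (1 - \<rho>)\<close> with \<open>\<rho>\<close> the ramp. This
  identity also holds outside the element, where both sides are 0, so the product rule applies on
  the whole interval.\<close>

lemma is_primitive_bubble:
  assumes m: "mesh xl xr n x"
  shows "is_primitive a b (bubble n x) (bubble_deriv n x)"
proof -
  have "is_primitive a b (\<lambda>t. if l < t \<and> t < r then (t - l) * (t - r) else 0)
      (\<lambda>t. if l < t \<and> t < r then 2 * t - l - r else 0)" if "l < r" for l r :: real
  proof -
    have "is_primitive a b (\<lambda>t. - ((r - l)\<^sup>2) * (ramp l r t * (1 - ramp l r t)))
        (\<lambda>t. - ((r - l)\<^sup>2) * (ramp l r t * (0 - ramp_deriv l r t) + (1 - ramp l r t) * ramp_deriv l r t))"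
      using that by (intro is_primitive_cmult is_primitive_mult is_primitive_diff is_primitive_const is_primitive_ramp)
    moreover have "(if l < t \<and> t < r then (t - l) * (t - r) else 0) = - ((r - l)\<^sup>2) * (ramp l r t * (1 - ramp l r t))" for t
    proof -
      consider "t \<le> l" | "r \<le> t" | "l < t" "t < r" by linarith
      then show ?thesis
      proof cases
        case 3
        have "1 - (t - l) / (r - l) = (r - t) / (r - l)" using that by (simp add: field_simps)
        then show ?thesis using 3 that by (simp add: ramp_mid power2_eq_square)
          (simp add: algebra_simps)
      qed (use that in \<open>auto simp: ramp_left ramp_right\<close>)
    qed
    moreover have "- ((r - l)\<^sup>2) * (ramp l r t * (0 - ramp_deriv l r t) + (1 - ramp l r t) * ramp_deriv l r t)
        = (if l < t \<and> t < r then 2 * t - l - r else 0)" for t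
    proof (cases "l < t \<and> t < r")
      case True
      \<comment> \<open>The derivative of \<open>- (r - l)^2 * y * (1 - y)\<close> is
        \<open>- (r - l) * (1 - 2 * y)\<close>, which is \<open>2 * t - l - r\<close>.\<close>
      define y where "y = (t - l) / (r - l)"
      have "(r - l) * y = t - l" using that by (simp add: y_def)
      moreover have "- (c\<^sup>2) * (y * (0 - 1 / c) + (1 - y) * (1 / c)) = - c * (1 - 2 * y)" if "c \<noteq> 0" for c
        using that by (simp add: power2_eq_square field_simps)
      from this[of "r - l"] have "- ((r - l)\<^sup>2) * (y * (0 - 1 / (r - l)) + (1 - y) * (1 / (r - l))) = - (r - l) * (1 - 2 * y)"
        using that by simp
      moreover have "ramp l r t = y" "ramp_deriv l r t = 1 / (r - l)"
        using True that by (simp_all add: ramp_mid ramp_deriv_def y_def)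
      ultimately show ?thesis
        by (simp only: if_P[OF True]) (simp add: left_diff_distrib right_diff_distrib)
    qed (auto simp: ramp_deriv_def)
    ultimately show ?thesis by simp
  qed
  then show ?thesis
    unfolding bubble_def[abs_def] bubble_deriv_def[abs_def]
    using m by (intro is_primitive_sum) (auto simp: mesh_def)
qed

lemma bubble_element:
  assumes m: "mesh xl xr n x" and k: "k < n" "x k < t" "t < x (Suc k)"
  shows "bubble n x t = (t - x k) * (t - x (Suc k))" "bubble_deriv n x t = 2 * t - x k - x (Suc k)"
proof -
  have "bubble n x t = (\<Sum>i<n. if i = k then (t - x k) * (t - x (Suc k)) else 0)"
    unfolding bubble_def using mesh_element_unique[OF m _ k] by (intro sum.cong) auto
  then show "bubble n x t = (t - x k) * (t - x (Suc k))" using k by simp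
  have "bubble_deriv n x t = (\<Sum>i<n. if i = k then 2 * t - x k - x (Suc k) else 0)"
    unfolding bubble_deriv_def using mesh_element_unique[OF m _ k] by (intro sum.cong) auto
  then show "bubble_deriv n x t = 2 * t - x k - x (Suc k)" using k by simp
qed

lemma bubble_node:
  assumes m: "mesh xl xr n x" and "j \<le> n"
  shows "bubble n x (x j) = 0"
  unfolding bubble_def
proof (rule sum.neutral, intro ballI)
  fix k assume "k \<in> {..<n}"
  then have "x j \<le> x k \<or> x (Suc k) \<le> x j"
    using mesh_le[OF m, of j k] mesh_le[OF m, of "Suc k" j] \<open>j \<le> n\<close> by (cases "j \<le> k") auto
  then show "(if x k < x j \<and> x j < x (Suc k) then (x j - x k) * (x j - x (Suc k)) else 0) = 0"
    by auto
qed

text \<open>\<open>element_estimate\<close> bounds the derivative of the corrected error on each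
  element, and the Poincare inequality bounds the error itself; both are summed over the mesh.
  \<open>M\<close> is sqrt 5 times the L2 norm of the derivative of \<open>f\<close>, divided by
  \<open>\<beta>\<close>.\<close>

lemma corrected_fem_error:
  fixes f g u uh :: "real \<Rightarrow> real"
  assumes "xl < xr" "\<beta> > 0"
    and u: "is_primitive xl xr u p" and p: "is_primitive xl xr p (\<lambda>t. - f t / \<beta>)"
    and F: "is_primitive xl xr F g" and g: "g \<in> L2 xl xr"
    and fF: "AE t in lebesgue_on {xl<..<xr}. F t = f t"
    and m: "mesh xl xr n x" and fem: "fem_solution xl xr \<beta> bl br f n x uh"
    and nodal: "\<And>k. k \<le> n \<Longrightarrow> uh (x k) = u (x k)"
  defines "w \<equiv> \<lambda>t. u t - u_new \<beta> f n x uh t"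
    and "h \<equiv> mesh_size n x"
    and "M \<equiv> sqrt (5 * integral {xl..xr} (\<lambda>t. (g t)\<^sup>2)) / \<beta>"
  shows "w \<in> H1 xl xr"
    and "L2_norm xl xr w \<le> M * h ^ 3"
    and "L2_norm xl xr (weak_deriv xl xr w) \<le> M * h ^ 2"
    and "energy_norm xl xr \<beta> bl br w = sqrt \<beta> * L2_norm xl xr (weak_deriv xl xr w)"
proof -
  obtain uh' \<sigma> where uh: "is_primitive xl xr uh uh'" "uh' \<in> L2 xl xr"
    and \<sigma>: "\<And>k t. k < n \<Longrightarrow> x k < t \<Longrightarrow> t < x (Suc k) \<Longrightarrow> uh' t = \<sigma> k"
    using fem_solution_primitive[OF fem m] by metis
  have n: "n \<ge> 1" "x 0 = xl" "x n = xr" using m by (auto simp: mesh_def)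
  define N where "N = integral {xl..xr} (\<lambda>t. (g t)\<^sup>2)"
  \<comment> \<open>The absolutely continuous representative of \<open>w\<close>: in the correction
    \<open>f\<close> is replaced by its continuous representative \<open>F\<close>. \<open>W\<close>
    is its derivative by the product rule.\<close>
  define V where "V t = u t - uh t + 1 / (2 * \<beta>) * (bubble n x t * F t)" for t
  define W where "W t = p t - uh' t + 1 / (2 * \<beta>) * (bubble n x t * g t + F t * bubble_deriv n x t)" for t
  have V: "is_primitive xl xr V W"
    unfolding V_def[abs_def] W_def[abs_def]
    by (intro is_primitive_add is_primitive_diff is_primitive_cmult is_primitive_mult u uh F is_primitive_bubble[OF m])
  have Vw: "AE t in lebesgue_on {xl<..<xr}. V t = w t"
    using fF by eventually_elim (simp add: V_def w_def u_new_bubble)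
  \<comment> \<open>Vanishing at the nodes is needed twice: for \<open>V\<close> in the Poincare
    inequality, and for \<open>w\<close> itself in the boundary terms of the energy form, since
    \<open>w\<close> and \<open>V\<close> agree only almost everywhere.\<close>
  have V_node: "V (x k) = 0" if "k \<le> n" for k
    using nodal[OF that] bubble_node[OF m that] by (simp add: V_def)
  have w_node: "w (x k) = 0" if "k \<le> n" for k
    using nodal[OF that] bubble_node[OF m that] by (simp add: w_def u_new_bubble)
  have h0: "h > 0" using mesh_size_bounds[OF m] by (simp add: h_def)
  have pF: "is_primitive xl xr p (\<lambda>t. - F t / \<beta>)"
  proof (rule is_primitive_cong[OF p])
    show "AE t in lebesgue_on {xl<..<xr}. - f t / \<beta> = - F t / \<beta>"
      using fF by eventually_elim simp
  qed simp
  have element: "W \<in> L2 (x k) (x (Suc k))"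
      "integral {x k..x (Suc k)} (\<lambda>t. (W t)\<^sup>2) \<le> 5 / \<beta>\<^sup>2 * h ^ 4 * integral {x k..x (Suc k)} (\<lambda>t. (g t)\<^sup>2)"
      "integral {x k..x (Suc k)} (\<lambda>t. (V t)\<^sup>2) \<le> h\<^sup>2 * integral {x k..x (Suc k)} (\<lambda>t. (W t)\<^sup>2)"
    if k: "k < n" for k
  proof -
    have cd: "x k < x (Suc k)" using mesh_less[OF m, of k "Suc k"] k by simp
    have sub: "xl \<le> x k" "x (Suc k) \<le> xr"
      using mesh_bounds[OF m, of k] mesh_bounds[OF m, of "Suc k"] k by auto
    have d: "0 \<le> x (Suc k) - x k" "x (Suc k) - x k \<le> h"
      using cd mesh_size_ge[OF k, of x] by (auto simp: h_def)
    have gL: "g \<in> L2 (x k) (x (Suc k))" using g sub by (rule L2_subinterval)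
    have Vk: "is_primitive (x k) (x (Suc k)) V W" using V sub by (rule is_primitive_subinterval)
    have "integral {x k..x (Suc k)} uh' = integral {x k<..<x (Suc k)} (\<lambda>_. \<sigma> k)"
      unfolding integral_open_interval_real using \<sigma>[OF k] by (intro Henstock_Kurzweil_Integration.integral_cong) auto
    then have uh_int: "integral {x k..x (Suc k)} uh' = \<sigma> k * (x (Suc k) - x k)"
      using cd by (simp flip: integral_open_interval_real)
    have "integral {x k..x (Suc k)} p = u (x (Suc k)) - u (x k)"
      using is_primitive_diff_eq[OF u sub(1) less_imp_le[OF cd] sub(2)] by simp
    also have "\<dots> = uh (x (Suc k)) - uh (x k)"
      using nodal k by simp
    also have "\<dots> = \<sigma> k * (x (Suc k) - x k)"
      using is_primitive_diff_eq[OF uh(1) sub(1) less_imp_le[OF cd] sub(2)] uh_int by simp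
    \<comment> \<open>Nodal exactness enters here: on each element the mean of \<open>p\<close> is
      the slope of the finite element solution.\<close>
    finally have mean: "integral {x k..x (Suc k)} p = \<sigma> k * (x (Suc k) - x k)" .
    have Wk: "W t = p t - \<sigma> k + ((2 * t - x k - x (Suc k)) * F t + (t - x k) * (t - x (Suc k)) * g t) / (2 * \<beta>)"
      if "t \<in> {x k<..<x (Suc k)}" for t
      using that bubble_element[OF m k, of t] \<sigma>[OF k, of t] by (simp add: W_def add.commute mult.commute)
    note est = element_estimate[OF cd \<open>\<beta> > 0\<close> is_primitive_subinterval[OF pF sub] is_primitive_subinterval[OF F sub]
        gL mean Wk is_primitive_absolutely_integrable[OF Vk]]
    show "W \<in> L2 (x k) (x (Suc k))" by (rule est(1))
    have "5 / \<beta>\<^sup>2 * (x (Suc k) - x k) ^ 4 * integral {x k..x (Suc k)} (\<lambda>t. (g t)\<^sup>2)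
        \<le> 5 / \<beta>\<^sup>2 * h ^ 4 * integral {x k..x (Suc k)} (\<lambda>t. (g t)\<^sup>2)"
      using d integral_square_nonneg[OF gL] by (intro mult_right_mono mult_left_mono power_mono) auto
    with est(2) show "integral {x k..x (Suc k)} (\<lambda>t. (W t)\<^sup>2) \<le> 5 / \<beta>\<^sup>2 * h ^ 4 * integral {x k..x (Suc k)} (\<lambda>t. (g t)\<^sup>2)"
      by (rule order_trans)
    have "integral {x k..x (Suc k)} (\<lambda>t. (V t)\<^sup>2) \<le> (x (Suc k) - x k)\<^sup>2 * integral {x k..x (Suc k)} (\<lambda>t. (W t)\<^sup>2)"
      using cd k V_node by (intro Poincare_interval[OF Vk est(1)]) auto
    also have "\<dots> \<le> h\<^sup>2 * integral {x k..x (Suc k)} (\<lambda>t. (W t)\<^sup>2)"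
      using d integral_square_nonneg[OF est(1)] by (intro mult_right_mono power_mono) auto
    finally show "integral {x k..x (Suc k)} (\<lambda>t. (V t)\<^sup>2) \<le> h\<^sup>2 * integral {x k..x (Suc k)} (\<lambda>t. (W t)\<^sup>2)" .
  qed
  have VL2: "V \<in> L2 xl xr" using is_primitive_continuous[OF V] by (rule L2_continuous)
  have sumW: "((\<lambda>t. (W t)\<^sup>2) has_integral (\<Sum>k<n. integral {x k..x (Suc k)} (\<lambda>t. (W t)\<^sup>2))) {xl..xr}"
    using m by (rule integral_mesh_sum) (use element(1) in \<open>auto simp: L2_iff intro: absolutely_integrable_on_imp_integrable_on\<close>)
  have sub2: "(\<lambda>t. (v t)\<^sup>2) integrable_on {x k..x (Suc k)}" if "v \<in> L2 xl xr" "k < n" for v k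
    using L2_subinterval[OF that(1), of "x k" "x (Suc k)"] mesh_bounds[OF m, of k] mesh_bounds[OF m, of "Suc k"] that(2)
    by (auto simp: L2_iff intro: absolutely_integrable_on_imp_integrable_on)
  have sumV: "((\<lambda>t. (V t)\<^sup>2) has_integral (\<Sum>k<n. integral {x k..x (Suc k)} (\<lambda>t. (V t)\<^sup>2))) {xl..xr}"
    using m sub2[OF VL2] by (rule integral_mesh_sum)
  have sumg: "((\<lambda>t. (g t)\<^sup>2) has_integral (\<Sum>k<n. integral {x k..x (Suc k)} (\<lambda>t. (g t)\<^sup>2))) {xl..xr}"
    using m sub2[OF g] by (rule integral_mesh_sum)
  \<comment> \<open>The square of \<open>W\<close> is integrable on the whole interval because it is
    on each of the finitely many elements.\<close>
  have WL2: "W \<in> L2 xl xr"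
    using is_primitive_absolutely_integrable[OF V] sumW
    by (auto simp: L2_iff intro!: nonnegative_absolutely_integrable_1)
  have W_le: "integral {xl..xr} (\<lambda>t. (W t)\<^sup>2) \<le> 5 / \<beta>\<^sup>2 * h ^ 4 * N"
    unfolding N_def integral_unique[OF sumW] integral_unique[OF sumg] sum_distrib_left
    by (intro sum_mono) (use element(2) in auto)
  \<comment> \<open>The Poincare inequality gains two powers of \<open>h\<close> in the square:
    \<open>h^6\<close> for \<open>V\<close> against \<open>h^4\<close> for \<open>W\<close>.\<close>
  have "integral {xl..xr} (\<lambda>t. (V t)\<^sup>2) \<le> h\<^sup>2 * integral {xl..xr} (\<lambda>t. (W t)\<^sup>2)"
    unfolding integral_unique[OF sumV] integral_unique[OF sumW] sum_distrib_left
    by (intro sum_mono) (use element(3) in auto)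
  also have "\<dots> \<le> h\<^sup>2 * (5 / \<beta>\<^sup>2 * h ^ 4 * N)"
    using W_le by (rule mult_left_mono) simp
  finally have V_le: "integral {xl..xr} (\<lambda>t. (V t)\<^sup>2) \<le> h\<^sup>2 * (5 / \<beta>\<^sup>2 * h ^ 4 * N)" .
  have N: "N \<ge> 0" unfolding N_def using g by (rule integral_square_nonneg)
  have M: "M \<ge> 0" "M\<^sup>2 = 5 * N / \<beta>\<^sup>2"
    using N \<open>\<beta> > 0\<close> by (simp_all add: M_def power_divide flip: N_def)
  show H1: "w \<in> H1 xl xr"
    using primitive_imp_H1(1)[OF V WL2 \<open>xl < xr\<close> Vw] .
  have Ww: "AE t in lebesgue_on {xl<..<xr}. W t = weak_deriv xl xr w t"
    using primitive_imp_H1(2)[OF V WL2 \<open>xl < xr\<close> Vw] .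
  have "L2_norm xl xr w = sqrt (integral {xl..xr} (\<lambda>t. (V t)\<^sup>2))"
    using VL2 Vw by (rule L2_norm_eq)
  also have "\<dots> \<le> M * h ^ 3"
  proof (rule real_le_lsqrt)
    have "(M * h ^ 3)\<^sup>2 = h\<^sup>2 * (5 / \<beta>\<^sup>2 * h ^ 4 * N)"
      by (simp add: power_mult_distrib M(2) flip: power_mult power_add)
    then show "integral {xl..xr} (\<lambda>t. (V t)\<^sup>2) \<le> (M * h ^ 3)\<^sup>2"
      using V_le by simp
  qed (use M h0 in auto)
  finally show "L2_norm xl xr w \<le> M * h ^ 3" .
  have normW: "L2_norm xl xr (weak_deriv xl xr w) = sqrt (integral {xl..xr} (\<lambda>t. (W t)\<^sup>2))"
    using WL2 Ww by (rule L2_norm_eq)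
  also have "\<dots> \<le> M * h ^ 2"
  proof (rule real_le_lsqrt)
    have "(M * h ^ 2)\<^sup>2 = 5 / \<beta>\<^sup>2 * h ^ 4 * N"
      by (simp add: power_mult_distrib M(2) flip: power_mult)
    then show "integral {xl..xr} (\<lambda>t. (W t)\<^sup>2) \<le> (M * h ^ 2)\<^sup>2"
      using W_le by simp
  qed (use M h0 in auto)
  finally show "L2_norm xl xr (weak_deriv xl xr w) \<le> M * h ^ 2" .
  \<comment> \<open>The Robin terms have no definite sign, but they vanish because \<open>w\<close>
    is 0 at both ends; hence the square root in the energy norm is harmless.\<close>
  have "bilin_form xl xr \<beta> bl br w w = \<beta> * integral {xl..xr} (\<lambda>t. W t * W t)"
    using bilin_form_eq[OF Vw V WL2 Vw V WL2 \<open>xl < xr\<close>] w_node[of 0] w_node[of n] n by simp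
  then show "energy_norm xl xr \<beta> bl br w = sqrt \<beta> * L2_norm xl xr (weak_deriv xl xr w)"
    by (simp add: energy_norm_def normW real_sqrt_mult power2_eq_square)
qed

text \<open>The error bounds are stated for \<open>f \<in> H1 xl xr\<close> because the correction
  contains \<open>f\<close> itself, so that the derivative of the corrected solution involves the
  weak derivative of \<open>f\<close>; nodal exactness is stated apart, for
  \<open>f \<in> L2 xl xr\<close>. Uniqueness is a hypothesis because a Robin coefficient of
  unfavourable sign admits nonzero homogeneous solutions even with a Dirichlet condition at the
  other end, for instance \<open>u(x) = x\<close> on \<open>(0, 1)\<close> with
  \<open>u(0) = 0\<close> and \<open>u'(1) = u(1)\<close>.\<close>

theorem theorem1:
  fixes xl xr \<beta> K :: real and bl br :: bc and f u :: "real \<Rightarrow> real"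
  assumes "xl < xr" and "\<beta> > 0"
    and "valid_bc bl" and "valid_bc br"
    and "is_Dirichlet bl \<or> is_Dirichlet br"
    and "f \<in> L2 xl xr" and "u \<in> H2 xl xr"
    and "bvp_solution xl xr \<beta> bl br f u"
    and unique: "\<And>v. bvp_solution xl xr \<beta> bl br f v \<Longrightarrow> \<forall>t\<in>{xl..xr}. v t = u t"
  shows "(f \<in> H1 xl xr \<longrightarrow>
           (\<exists>C. \<forall>n x uh. mesh xl xr n x \<and> mesh_size n x \<le> K / real n \<and>
                 fem_solution xl xr \<beta> bl br f n x uh \<longrightarrow>
               (\<lambda>t. u t - u_new \<beta> f n x uh t) \<in> H1 xl xr \<and>
               L2_norm xl xr (\<lambda>t. u t - u_new \<beta> f n x uh t) \<le> C * mesh_size n x ^ 3 \<and>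
               H1_norm xl xr (\<lambda>t. u t - u_new \<beta> f n x uh t) \<le> C * mesh_size n x ^ 2 \<and>
               energy_norm xl xr \<beta> bl br (\<lambda>t. u t - u_new \<beta> f n x uh t) \<le> C * mesh_size n x ^ 2))
       \<and> (\<forall>n x uh. mesh xl xr n x \<and> fem_solution xl xr \<beta> bl br f n x uh \<longrightarrow>
             (\<forall>k\<le>n. u_new \<beta> f n x uh (x k) = u (x k)))"
proof (rule conjI)
  have nodal: "uh (x k) = u (x k)"
    if "mesh xl xr n x" "fem_solution xl xr \<beta> bl br f n x uh" "k \<le> n" for n x uh k
    using fem_nodal_exactness[OF assms(1-4,6,8) unique that] .
  show "\<forall>n x uh. mesh xl xr n x \<and> fem_solution xl xr \<beta> bl br f n x uh \<longrightarrow>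
             (\<forall>k\<le>n. u_new \<beta> f n x uh (x k) = u (x k))"
    using nodal bubble_node by (fastforce simp: u_new_bubble)
  show "f \<in> H1 xl xr \<longrightarrow>
           (\<exists>C. \<forall>n x uh. mesh xl xr n x \<and> mesh_size n x \<le> K / real n \<and>
                 fem_solution xl xr \<beta> bl br f n x uh \<longrightarrow>
               (\<lambda>t. u t - u_new \<beta> f n x uh t) \<in> H1 xl xr \<and>
               L2_norm xl xr (\<lambda>t. u t - u_new \<beta> f n x uh t) \<le> C * mesh_size n x ^ 3 \<and>
               H1_norm xl xr (\<lambda>t. u t - u_new \<beta> f n x uh t) \<le> C * mesh_size n x ^ 2 \<and>
               energy_norm xl xr \<beta> bl br (\<lambda>t. u t - u_new \<beta> f n x uh t) \<le> C * mesh_size n x ^ 2)"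
  proof
    assume "f \<in> H1 xl xr"
    then obtain F where F: "is_primitive xl xr F (weak_deriv xl xr f)" "AE t in lebesgue_on {xl<..<xr}. F t = f t"
      using H1_imp_primitive \<open>xl < xr\<close> by blast
    note g = weak_deriv_H1(1)[OF \<open>f \<in> H1 xl xr\<close>]
    obtain p where p: "is_primitive xl xr u p" "is_primitive xl xr p (\<lambda>t. - f t / \<beta>)"
      using bvp_solution_imp_primitives[OF assms(8,1,2)] .
    define M where "M = sqrt (5 * integral {xl..xr} (\<lambda>t. (weak_deriv xl xr f t)\<^sup>2)) / \<beta>"
    have M: "M \<ge> 0"
      using integral_square_nonneg[OF g] \<open>\<beta> > 0\<close> by (simp add: M_def)
    \<comment> \<open>\<open>M\<close> serves the L2 bound, \<open>M * (1 + (xr - xl))\<close> the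
      H1 bound, where one factor of the mesh size is estimated by the length of the interval, and
      \<open>M * sqrt \<beta>\<close> the energy bound. None of them depends on the mesh.\<close>
    define C where "C = M * (1 + (xr - xl) + sqrt \<beta>)"
    show "\<exists>C. \<forall>n x uh. mesh xl xr n x \<and> mesh_size n x \<le> K / real n \<and>
                 fem_solution xl xr \<beta> bl br f n x uh \<longrightarrow>
               (\<lambda>t. u t - u_new \<beta> f n x uh t) \<in> H1 xl xr \<and>
               L2_norm xl xr (\<lambda>t. u t - u_new \<beta> f n x uh t) \<le> C * mesh_size n x ^ 3 \<and>
               H1_norm xl xr (\<lambda>t. u t - u_new \<beta> f n x uh t) \<le> C * mesh_size n x ^ 2 \<and>
               energy_norm xl xr \<beta> bl br (\<lambda>t. u t - u_new \<beta> f n x uh t) \<le> C * mesh_size n x ^ 2"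
    proof (intro exI[of _ C] allI impI, elim conjE)
      fix n x uh
      assume m: "mesh xl xr n x" and fem: "fem_solution xl xr \<beta> bl br f n x uh"
      let ?w = "\<lambda>t. u t - u_new \<beta> f n x uh t" and ?h = "mesh_size n x"
      have h: "0 < ?h" "?h \<le> xr - xl" using mesh_size_bounds[OF m] by auto
      have err: "?w \<in> H1 xl xr" "L2_norm xl xr ?w \<le> M * ?h ^ 3"
        "L2_norm xl xr (weak_deriv xl xr ?w) \<le> M * ?h ^ 2"
        "energy_norm xl xr \<beta> bl br ?w = sqrt \<beta> * L2_norm xl xr (weak_deriv xl xr ?w)"
        unfolding M_def
        by (rule corrected_fem_error[OF assms(1,2) p F(1) g F(2) m fem nodal[OF m fem]]; assumption)+
      have "0 \<le> sqrt \<beta>" using \<open>\<beta> > 0\<close> by simp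
      then have "M * 1 \<le> C" and C: "M * (1 + (xr - xl)) \<le> C" "M * sqrt \<beta> \<le> C"
        unfolding C_def using \<open>xl < xr\<close> by (intro mult_left_mono M; linarith)+
      then have C1: "M \<le> C" by simp
      have "L2_norm xl xr ?w \<le> C * ?h ^ 3"
        by (rule order_trans[OF err(2) mult_right_mono[OF C1]]) (use h in auto)
      moreover have "H1_norm xl xr ?w \<le> C * ?h ^ 2"
      proof -
        have nonneg: "0 \<le> L2_norm xl xr v" for v by (simp add: L2_norm_def)
        have "H1_norm xl xr ?w \<le> L2_norm xl xr ?w + L2_norm xl xr (weak_deriv xl xr ?w)"
          unfolding H1_norm_def by (rule sqrt_sum_squares_le_sum) (rule nonneg)+
        also have "\<dots> \<le> M * ?h ^ 3 + M * ?h ^ 2"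
          using err(2,3) by (rule add_mono)
        also have "\<dots> = M * (1 + ?h) * ?h ^ 2"
          by (simp add: algebra_simps power3_eq_cube power2_eq_square)
        also have "\<dots> \<le> M * (1 + (xr - xl)) * ?h ^ 2"
          using M h by (intro mult_right_mono mult_left_mono) auto
        also have "\<dots> \<le> C * ?h ^ 2"
          using C(1) by (rule mult_right_mono) simp
        finally show ?thesis .
      qed
      moreover have "energy_norm xl xr \<beta> bl br ?w \<le> C * ?h ^ 2"
      proof -
        have "energy_norm xl xr \<beta> bl br ?w \<le> sqrt \<beta> * (M * ?h ^ 2)"
          unfolding err(4) using err(3) \<open>\<beta> > 0\<close> by (intro mult_left_mono) auto
        also have "\<dots> = M * sqrt \<beta> * ?h ^ 2" by simp
        also have "\<dots> \<le> C * ?h ^ 2"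
          using C(2) by (rule mult_right_mono) simp
        finally show ?thesis .
      qed
      ultimately show "?w \<in> H1 xl xr \<and> L2_norm xl xr ?w \<le> C * ?h ^ 3 \<and> H1_norm xl xr ?w \<le> C * ?h ^ 2
          \<and> energy_norm xl xr \<beta> bl br ?w \<le> C * ?h ^ 2"
        using err(1) by blast
    qed
  qed
qed

end
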